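(* Let $R$ be a Dedekind domain with fraction field $K$, let $\mathbf{X}\in R^{n\times n}$ be a symmetric matrix, and suppose that $\mathbf{Y}\in R^{n\times n}$ and a nonzero matrix $\mathbf{Q}\in K^{n\times n}$ satisfy $\mathbf{X}\mathbf{Q}=\mathbf{Q}\mathbf{Y}$ and $\mathbf{Q}^{\mathsf T}\mathbf{Q}\in R^{n\times n}$. Let $\mathcal{L}$ be the level of $\mathbf{Q}$, let $\mathcal{P}\subseteq R$ be a nonzero prime ideal, let $\Gamma\in(R/\mathcal{P})[x]$ be the approximate square root of $\phi_{\mathbf{X}}$ modulo $\mathcal{P}$, and let $e\geq 1$ be an integer such that $\mathcal{P}^e\mid\mathcal{L}$. Then there exist $m\geq 1$ vectors $w_1,\dots,w_m\in R^n$, not all zero modulo $\mathcal{P}$, whose Krylov space $\mathcal{K}_{\mathbf{X}}(w_1,\dots,w_m)$ is $\Gamma$-contractive up to level $\mathcal{P}^e$ and isotropic up to level $\mathcal{P}^{2e}$ and such that $$\operatorname{Im}_R(\mathcal{L}\mathbf{Q})=\mathcal{K}_{\mathbf{X}}(w_1,\dots,w_m).$$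
   Context: Rings are commutative and unital. The level of $\mathbf{Q}$ is the ideal $\mathcal{L}=\{r\in R: r\mathbf{Q}\in R^{n\times n}\}$, and $\operatorname{Im}_R(\mathcal{L}\mathbf{Q})$ is the $R$-submodule of $R^n$ consisting of all finite sums $\sum_i\ell_i\mathbf{Q}v_i$ with $\ell_i\in\mathcal{L}$, $v_i\in R^n$. For ideals, $\mathcal{B}\mid\mathcal{A}$ means $\mathcal{B}\mathcal{C}=\mathcal{A}$ for some ideal $\mathcal{C}\subseteq R$. For vectors, $w\equiv 0\bmod\mathcal{I}$ means that all entries lie in the ideal $\mathcal{I}$. Approximate square root: let $\phi_{\mathbf{X}}(x)=\det(x\mathbf{I}-\mathbf{X})$ and factor $\phi_{\mathbf{X}}\equiv\prod_{i=1}^m\gamma_i^{d_i}\bmod\mathcal{P}$ with $\gamma_1,\dots,\gamma_m\in\mathbb{F}_{\mathcal{P}}[x]$ distinct monic irreducible, $d_i\ge1$, $\mathbb{F}_{\mathcal{P}}=R/\mathcal{P}$. Then $\Gamma=\prod_{i=1}^m\gamma_i^{\lfloor d_i/2\rfloor}$. An $R$-submodule $\mathcal{M}\subseteq R^n$ is $\Gamma$-contractive up to level $\mathcal{P}^e$ if for every integer $0\le k\leq e-1$ and every $q\in\mathcal{M}\cap(\mathcal{P}^k)^n$ one has $\Gamma(\mathbf{X})q\equiv 0\bmod\mathcal{P}^{k+1}$ (here $\Gamma$ may be replaced by any lift to $R[x]$; the condition does not depend on the lift, and $\mathcal{P}^0=R$). It is isotropic up to level $\mathcal{P}^{e}$ if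 $q_1^{\mathsf T}q_2\equiv 0\bmod\mathcal{P}^{e}$ for all $q_1,q_2\in\mathcal{M}$. The Krylov space of $w_1,\dots,w_m\in R^n$ is $\mathcal{K}_{\mathbf{X}}(w_1,\dots,w_m)=\{\sum_{j=1}^m\sum_{i=0}^{n-1}c_{i,j}\mathbf{X}^iw_j: c_{i,j}\in R\}$. *)

theory Defs
  imports
    "Jordan_Normal_Form.Char_Poly"
    "Jordan_Normal_Form.VS_Connect"
    "HOL-Algebra.Ideal_Product"
    "HOL-Algebra.Polynomial_Divisibility"
begin

text \<open>The ring \<open>R\<close> is a type \<open>'a\<close> of class \<open>idom\<close>, its fraction field \<open>K\<close> is \<open>'a fract\<close>, with the
embedding \<open>to_fract\<close>; matrices and vectors are those of \<open>Jordan_Normal_Form.Matrix\<close>. Ideals,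
quotients and polynomials over \<open>R/P\<close> are taken from HOL-Algebra, where \<open>R\<close> appears as the record
\<open>class_ring\<close>.\<close>

text \<open>Fields satisfy this definition. A field has no nonzero prime ideal, so it does not matter here
whether fields are counted as Dedekind domains.\<close>

definition dedekind_domain :: "'a::idom itself \<Rightarrow> bool" where
  "dedekind_domain _ \<longleftrightarrow>
     noetherian_domain (class_ring :: 'a ring) \<and>
     (\<forall>P. primeideal P (class_ring :: 'a ring) \<and> P \<noteq> {0} \<longrightarrow> maximalideal P class_ring) \<and>
     (\<forall>z :: 'a fract.
        (\<exists>p :: 'a poly. Polynomial.lead_coeff p = 1 \<and> poly (map_poly to_fract p) z = 0) \<longrightarrow>
        z \<in> range to_fract)"

text \<open>\<open>ideal_pow P 0\<close> is the unit ideal.\<close>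

definition ideal_pow :: "'a::idom set \<Rightarrow> nat \<Rightarrow> 'a set" where
  "ideal_pow P k = P [^]\<^bsub>ideals_set class_ring\<^esub> k"

definition ideal_dvd :: "'a::idom set \<Rightarrow> 'a set \<Rightarrow> bool" where
  "ideal_dvd B A \<longleftrightarrow> (\<exists>C. ideal C class_ring \<and> ideal_prod class_ring B C = A)"

definition integral_mats :: "nat \<Rightarrow> 'a::idom fract mat set" where
  "integral_mats n = map_mat to_fract ` carrier_mat n n"

definition level :: "nat \<Rightarrow> 'a::idom fract mat \<Rightarrow> 'a set" where
  "level n Q = {r. to_fract r \<cdot>\<^sub>m Q \<in> integral_mats n}"

text \<open>The module \<open>Im\<^sub>R(L Q)\<close> is formed inside \<open>K\<^sup>n\<close>, where the products \<open>l Q v\<close> live. When \<open>L\<close> is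
the level of \<open>Q\<close> it lies in the copy \<open>map_vec to_fract ` carrier_vec n\<close> of \<open>R\<^sup>n\<close>.\<close>

definition module_image :: "nat \<Rightarrow> 'a::idom set \<Rightarrow> 'a fract mat \<Rightarrow> 'a fract vec set" where
  "module_image n L Q =
     {finsum_vec TYPE('a fract) n
        (\<lambda>i. to_fract (l i) \<cdot>\<^sub>v (Q *\<^sub>v map_vec to_fract (v i))) {..<k} | (k::nat) l v.
      \<forall>i<k. l i \<in> L \<and> v i \<in> carrier_vec n}"

definition vec_cong0 :: "'a::idom vec \<Rightarrow> 'a set \<Rightarrow> bool" where
  "vec_cong0 w I \<longleftrightarrow> (\<forall>i<dim_vec w. w $ i \<in> I)"

definition krylov :: "nat \<Rightarrow> 'a::idom mat \<Rightarrow> nat \<Rightarrow> (nat \<Rightarrow> 'a vec) \<Rightarrow> 'a vec set" where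
  "krylov n M m w =
     {finsum_vec TYPE('a) n
        (\<lambda>j. finsum_vec TYPE('a) n (\<lambda>i. c i j \<cdot>\<^sub>v ((M ^\<^sub>m i) *\<^sub>v w j)) {0..<n}) {1..m} | c. True}"

definition mat_eval :: "nat \<Rightarrow> 'a::idom poly \<Rightarrow> 'a mat \<Rightarrow> 'a mat" where
  "mat_eval n g M =
     finsum (ring_mat TYPE('a) n ()) (\<lambda>i. Polynomial.coeff g i \<cdot>\<^sub>m (M ^\<^sub>m i)) {..Polynomial.degree g}"

abbreviation residue_field :: "'a::idom set \<Rightarrow> 'a set ring" where
  "residue_field P \<equiv> class_ring Quot P"

text \<open>Polynomials over \<open>R/P\<close> are lists of cosets of \<open>P\<close>, leading coefficient first.\<close>

definition reduce_poly :: "'a::idom set \<Rightarrow> 'a poly \<Rightarrow> 'a set list" where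
  "reduce_poly P f =
     ring.normalize (residue_field P) (map (\<lambda>c. P +>\<^bsub>class_ring\<^esub> c) (rev (coeffs f)))"

lemma reduce_poly_surj:
  fixes P :: "'a::idom set"
  assumes P: "ideal P class_ring" and p: "p \<in> carrier (poly_ring (residue_field P))"
  shows "\<exists>g. reduce_poly P g = p"
proof (cases "p = []")
  case True
  interpret Q: ring "residue_field P" using P by (rule ideal.quotient_is_ring)
  show ?thesis using True by (intro exI[of _ 0]) (simp add: reduce_poly_def)
next
  case False
  interpret P: ideal P "class_ring :: 'a ring" by (rule P)
  interpret Q: ring "residue_field P" by (rule P.quotient_is_ring)
  have sub: "set p \<subseteq> carrier (residue_field P)" and hd: "hd p \<noteq> P"
    using p False unfolding univ_poly_def polynomial_def by (auto simp: FactRing_def)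
  have zero: "\<zero>\<^bsub>residue_field P\<^esub> = P" by (simp add: FactRing_def)
  have "\<exists>c. P +>\<^bsub>class_ring\<^esub> c = x" if "x \<in> set p" for x
    using sub that by (auto simp: FactRing_def A_RCOSETS_def' subset_iff)
  then obtain f where f: "\<And>x. x \<in> set p \<Longrightarrow> P +>\<^bsub>class_ring\<^esub> f x = x" by metis
  define rs where "rs = map f p"
  have rs: "map (\<lambda>c. P +>\<^bsub>class_ring\<^esub> c) rs = p"
    unfolding rs_def by (simp add: f map_idI)
  have "P +>\<^bsub>class_ring\<^esub> hd rs = hd p" using False f by (simp add: rs_def hd_map)
  moreover have "P +>\<^bsub>class_ring\<^esub> 0 = P" by (auto simp: a_r_coset_def')
  ultimately have "hd rs \<noteq> 0" using hd by auto
  then have "coeffs (Poly (rev rs)) = rev rs"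
    using False by (cases p) (auto simp: rs_def strip_while_def)
  moreover have "ring.normalize (residue_field P) p = p"
    using False hd by (cases p) (simp_all add: zero)
  ultimately show ?thesis using rs by (intro exI[of _ "Poly (rev rs)"]) (simp add: reduce_poly_def)
qed

definition is_approx_sqrt :: "'a::idom set \<Rightarrow> 'a mat \<Rightarrow> 'a set list \<Rightarrow> bool" where
  "is_approx_sqrt P M \<Gamma> \<longleftrightarrow>
     (\<exists>(m::nat) \<gamma> (d :: nat \<Rightarrow> nat).
        (\<forall>i\<in>{1..m}. \<gamma> i \<in> carrier (poly_ring (residue_field P)) \<and>
           ring_irreducible\<^bsub>poly_ring (residue_field P)\<^esub> (\<gamma> i) \<and>
           hd (\<gamma> i) = \<one>\<^bsub>residue_field P\<^esub> \<and> 1 \<le> d i) \<and>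
        inj_on \<gamma> {1..m} \<and>
        reduce_poly P (char_poly M) =
          (\<Otimes>\<^bsub>poly_ring (residue_field P)\<^esub>i\<in>{1..m}. \<gamma> i [^]\<^bsub>poly_ring (residue_field P)\<^esub> d i) \<and>
        \<Gamma> = (\<Otimes>\<^bsub>poly_ring (residue_field P)\<^esub>i\<in>{1..m}. \<gamma> i [^]\<^bsub>poly_ring (residue_field P)\<^esub> (d i div 2)))"

text \<open>\<open>\<Gamma>(M)\<close> is evaluated through the lifts \<open>g\<close> of \<open>\<Gamma>\<close> to \<open>R[x]\<close>. All lifts give the same condition;
the definition quantifies over all of them, and at least one exists by \<open>reduce_poly_surj\<close>.\<close>

definition contractive ::
    "nat \<Rightarrow> 'a::idom mat \<Rightarrow> 'a set list \<Rightarrow> 'a set \<Rightarrow> nat \<Rightarrow> 'a vec set \<Rightarrow> bool" where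
  "contractive n M \<Gamma> P e N \<longleftrightarrow>
     (\<forall>g. reduce_poly P g = \<Gamma> \<longrightarrow>
       (\<forall>k<e. \<forall>q\<in>N. vec_cong0 q (ideal_pow P k) \<longrightarrow>
          vec_cong0 (mat_eval n g M *\<^sub>v q) (ideal_pow P (k + 1))))"

definition isotropic :: "'a::idom set \<Rightarrow> 'a vec set \<Rightarrow> bool" where
  "isotropic I N \<longleftrightarrow> (\<forall>q1\<in>N. \<forall>q2\<in>N. q1 \<bullet> q2 \<in> I)"

end

theory Submission
  imports Defs
begin

text \<open>The module \<open>M = Im(L Q)\<close> is finitely generated and \<open>X\<close>-invariant, hence a Krylov space, and it is
isotropic modulo \<open>P\<^sup>2\<^sup>e\<close> because \<open>L \<subseteq> P\<^sup>e\<close> and \<open>Q\<^sup>T Q\<close> is integral. If \<open>M\<close> vanished modulo \<open>P\<close>, then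
\<open>P\<^sup>-\<^sup>1 L\<close> would lie in the level, which is impossible.

For contractivity, take \<open>q \<in> M\<close> with entries in \<open>P\<^sup>k\<close>. Up to a factor prime to \<open>P\<close>, \<open>q = \<pi>\<^sup>k u\<close> for a local
uniformizer \<open>\<pi>\<close>, and \<open>u\<close> generates an isotropic Krylov space modulo \<open>P\<close>. Let \<open>h = adj(x - X) u\<close>. Then
\<open>u\<^sup>T h = 0\<close> modulo \<open>P\<close>, and since \<open>det A\<close> divides the \<open>2 \<times> 2\<close> minors of \<open>adj A\<close> in any pair of vectors, the
characteristic polynomial \<open>\<phi>\<close> divides \<open>h\<^sub>i\<^sup>2\<close> modulo \<open>P\<close> for every \<open>i\<close>. Hence \<open>\<phi>\<close> divides \<open>\<Gamma> h\<^sub>i\<close>, and dividing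
\<open>(x - X) \<Gamma> h = \<phi> \<Gamma> u\<close> by \<open>\<phi>\<close> and evaluating at \<open>x = X\<close> gives \<open>\<Gamma>(X) u = 0\<close> modulo \<open>P\<close>.\<close>

section \<open>Ideals of a type-class ring\<close>

text \<open>Symmetry of X enters through the pair u, e_i: the minor of adj(x - X) for this pair is
  (u^T h)(e_i^T adj(x - X) e_i) - h_i^2, because both off-diagonal products equal h_i. This is how
  isotropy of u alone controls every h_i^2. The floors in \<Gamma> match multiplicities: \<phi> |
  h_i^2 forces each factor into h_i at least ceil(d/2) times, and floor(d/2) + ceil(d/2) = d. The
  exponent 2e matches k < e: passing from q to u costs 2k factors of P in q^T X^j q, and 2k + 1
  \<le> 2e leaves one. Since R need not be local, \<pi> generates P only up to a factor s outside P;
  such an s is invertible modulo every power of P and is cancelled at the end. Polynomial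
  congruences are kept in R[x] modulo P[x], so that determinants can be cancelled before reduction;
  only the argument about irreducible factors passes to the residue field. P^-1 L cannot lie in L,
  since an element of P^-1 outside R would then stabilize a nonzero finitely generated ideal and so
  be integral over R.\<close>

lemma class_idealI:
  fixes I :: "'a::idom set"
  assumes "0 \<in> I" and "\<And>a b. a \<in> I \<Longrightarrow> b \<in> I \<Longrightarrow> a + b \<in> I" and "\<And>r a. a \<in> I \<Longrightarrow> r * a \<in> I"
  shows "ideal I class_ring"
proof (rule idealI)
  show "ring (class_ring :: 'a ring)" by (rule class_ring.ring_axioms)
  have inv: "inv\<^bsub>add_monoid class_ring\<^esub> a = - a" for a :: 'a
    using abelian_group.minus_equality[OF ring.is_abelian_group[OF class_ring.ring_axioms], of "- a" a]
    by (simp add: a_inv_def)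
  show "subgroup I (add_monoid class_ring)"
    using assms(1,2) assms(3)[of _ "-1"]
    by (intro subgroup.intro) (auto simp: inv[simplified])
qed (use assms(3) in \<open>auto simp: mult.commute\<close>)

lemma class_ideal:
  fixes I :: "'a::idom set"
  assumes "ideal I class_ring"
  shows class_ideal_zero: "0 \<in> I"
    and class_ideal_add: "\<And>a b. a \<in> I \<Longrightarrow> b \<in> I \<Longrightarrow> a + b \<in> I"
    and class_ideal_mult: "\<And>r a. a \<in> I \<Longrightarrow> r * a \<in> I"
    and class_ideal_mult_right: "\<And>r a. a \<in> I \<Longrightarrow> a * r \<in> I"
    and class_ideal_uminus: "\<And>a. a \<in> I \<Longrightarrow> - a \<in> I"
    and class_ideal_diff: "\<And>a b. a \<in> I \<Longrightarrow> b \<in> I \<Longrightarrow> a - b \<in> I"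
    and class_ideal_sum: "\<And>f (S :: 'c set). (\<And>x. x \<in> S \<Longrightarrow> f x \<in> I) \<Longrightarrow> sum f S \<in> I"
proof -
  interpret ideal I "class_ring :: 'a ring" by (rule assms)
  show zero: "0 \<in> I" using zero_closed by simp
  show add: "a + b \<in> I" if "a \<in> I" "b \<in> I" for a b using a_closed[OF that] by simp
  show mult: "r * a \<in> I" if "a \<in> I" for r a using I_l_closed[OF that, of r] by simp
  show "a * r \<in> I" if "a \<in> I" for r a using mult[OF that, of r] by (simp add: mult.commute)
  show um: "- a \<in> I" if "a \<in> I" for a using mult[OF that, of "-1"] by simp
  show "a - b \<in> I" if "a \<in> I" "b \<in> I" for a b using add[OF that(1) um[OF that(2)]] by simp
  show "sum f S \<in> I" if "\<And>x. x \<in> S \<Longrightarrow> f x \<in> I" for f and S :: "'c set"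
    using that by (induction S rule: infinite_finite_induct) (auto simp: zero add)
qed

lemma class_primeideal:
  fixes P :: "'a::idom set"
  assumes "primeideal P class_ring"
  shows "1 \<notin> P" and "\<And>a b. a * b \<in> P \<Longrightarrow> a \<in> P \<or> b \<in> P"
proof -
  interpret primeideal P "class_ring :: 'a ring" by (rule assms)
  show "1 \<notin> P" using I_notcarr one_imp_carrier by auto
  show "a * b \<in> P \<Longrightarrow> a \<in> P \<or> b \<in> P" for a b using I_prime[of a b] by simp
qed

lemma class_prime_power:
  fixes P :: "'a::idom set"
  assumes "primeideal P class_ring" and "s \<notin> P"
  shows "s ^ k \<notin> P"
  using assms by (induction k) (auto dest: class_primeideal)

lemma ideal_pow_0: "ideal_pow P 0 = (UNIV :: 'a::idom set)"
  by (simp add: ideal_pow_def ideals_set_def)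

lemma ideal_pow_Suc: "ideal_pow P (Suc k) = ideal_prod class_ring (ideal_pow P k) P"
  by (simp add: ideal_pow_def ideals_set_def)

lemma ideal_pow_1:
  fixes P :: "'a::idom set"
  assumes "ideal P class_ring"
  shows "ideal_pow P 1 = P"
proof -
  interpret I: comm_monoid "ideals_set (class_ring :: 'a ring)"
    using cring.ideals_set_is_comm_monoid[OF class_cring.cring_axioms] .
  have "P \<in> carrier (ideals_set class_ring)" using assms by (simp add: ideals_set_def)
  then show ?thesis unfolding ideal_pow_def by (simp del: One_nat_def)
qed

lemma ideal_ideal_pow:
  fixes P :: "'a::idom set"
  assumes "ideal P class_ring"
  shows "ideal (ideal_pow P k) class_ring"
proof (induction k)
  case 0
  show ?case using ring.oneideal[OF class_ring.ring_axioms] by (simp add: ideal_pow_0)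
next
  case (Suc k)
  show ?case using ring.ideal_prod_is_ideal[OF class_ring.ring_axioms Suc assms]
    by (simp add: ideal_pow_Suc)
qed

lemma ideal_pow_mult:
  fixes P :: "'a::idom set"
  assumes P: "ideal P class_ring" and "x \<in> ideal_pow P i" "y \<in> ideal_pow P j"
  shows "x * y \<in> ideal_pow P (i + j)"
proof -
  interpret I: comm_monoid "ideals_set (class_ring :: 'a ring)"
    using cring.ideals_set_is_comm_monoid[OF class_cring.cring_axioms] .
  have "ideal_pow P (i + j) = ideal_prod class_ring (ideal_pow P i) (ideal_pow P j)"
    using I.nat_pow_mult[of P i j] P by (simp add: ideal_pow_def ideals_set_def)
  moreover have "x \<otimes>\<^bsub>class_ring\<^esub> y \<in> ideal_prod class_ring (ideal_pow P i) (ideal_pow P j)"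
    using assms(2,3) by (rule ideal_prod.prod)
  ultimately show ?thesis by simp
qed

lemma power_in_ideal_pow:
  fixes P :: "'a::idom set"
  assumes P: "ideal P class_ring" and x: "x \<in> P"
  shows "x ^ k \<in> ideal_pow P k"
proof (induction k)
  case (Suc k)
  show ?case using ideal_pow_mult[OF P Suc, of x 1] x ideal_pow_1[OF P] by (simp add: mult.commute)
qed (simp add: ideal_pow_0)

lemma ideal_pow_antimono:
  fixes P :: "'a::idom set"
  assumes P: "ideal P class_ring" and "i \<le> j"
  shows "ideal_pow P j \<subseteq> ideal_pow P i"
  using \<open>i \<le> j\<close>
proof (induction j rule: dec_induct)
  case (step j)
  have "ideal_pow P (Suc j) \<subseteq> ideal_pow P j \<inter> P" unfolding ideal_pow_Suc
    by (rule ring.ideal_prod_inter[OF class_ring.ring_axioms ideal_ideal_pow[OF P] P])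
  then show ?case using step by auto
qed auto

lemma ideal_dvd_subset:
  fixes B :: "'a::idom set"
  assumes "ideal B class_ring" "ideal_dvd B A"
  shows "A \<subseteq> B"
  using assms ring.ideal_prod_inter[OF class_ring.ring_axioms] unfolding ideal_dvd_def by auto

section \<open>Dedekind domains\<close>

lemma maximalideal_imp_coprime:
  fixes P :: "'a::idom set"
  assumes P: "maximalideal P class_ring" and s: "s \<notin> P"
  obtains t p where "p \<in> P" "t * s + p = 1"
proof -
  interpret maximalideal P "class_ring :: 'a ring" by (rule P)
  have I: "ideal P class_ring" by unfold_locales
  note cl = class_ideal[OF I]
  define J where "J = {t * s + p | t p. p \<in> P}"
  have "ideal J class_ring"
  proof (rule class_idealI)
    show "0 \<in> J" unfolding J_def using cl(1) by (auto intro!: exI[of _ 0])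
    show "a + b \<in> J" if "a \<in> J" "b \<in> J" for a b
    proof -
      from that obtain t p t' p' where "a = t * s + p" "p \<in> P" "b = t' * s + p'" "p' \<in> P"
        unfolding J_def by blast
      then have "a + b = (t + t') * s + (p + p')" "p + p' \<in> P" using cl(2) by (auto simp: algebra_simps)
      then show ?thesis unfolding J_def by blast
    qed
    show "r * a \<in> J" if "a \<in> J" for r a
    proof -
      from that obtain t p where "a = t * s + p" "p \<in> P" unfolding J_def by blast
      then have "r * a = (r * t) * s + r * p" "r * p \<in> P" using cl(3) by (auto simp: algebra_simps)
      then show ?thesis unfolding J_def by blast
    qed
  qed
  moreover have "P \<subseteq> J" unfolding J_def by (force intro: exI[of _ 0])
  moreover have "s \<in> J" unfolding J_def using cl(1) by (force intro: exI[of _ 1])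
  ultimately have "J = UNIV" using I_maximal[of J] s by auto
  then have "1 \<in> J" by simp
  then show ?thesis using that unfolding J_def by auto
qed

text \<open>An element outside the maximal ideal P is invertible modulo P, hence modulo every P^k:
  expanding 1 = (p + t s)^k leaves p^k, which lies in P^k, plus a multiple of s.\<close>

lemma ideal_pow_cancel:
  fixes P :: "'a::idom set"
  assumes P: "maximalideal P class_ring" and s: "s \<notin> P" and "s * y \<in> ideal_pow P k"
  shows "y \<in> ideal_pow P k"
proof -
  have I: "ideal P class_ring" using P by (simp add: maximalideal_def)
  note cl = class_ideal[OF ideal_ideal_pow[OF I, of k]]
  obtain t p where p: "p \<in> P" "t * s + p = 1" using maximalideal_imp_coprime[OF P s] .
  have "(1 :: 'a) = (p + t * s) ^ k" using p by (simp add: add.commute)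
  have "\<exists>c. (p + t * s) ^ j = p ^ j + c * s" for j
  proof (induction j)
    case 0
    show ?case by (auto intro: exI[of _ 0])
  next
    case (Suc j)
    then obtain c where c: "(p + t * s) ^ j = p ^ j + c * s" by blast
    have "(p + t * s) ^ Suc j = p ^ Suc j + (p * c + t * p ^ j + t * s * c) * s"
      by (simp only: power_Suc c) (simp add: algebra_simps)
    then show ?case by blast
  qed
  then obtain c where "(p + t * s) ^ k = p ^ k + c * s" by blast
  then have "y = p ^ k * y + c * (s * y)"
    using p by (metis add.commute distrib_right mult.assoc mult_1 power_one)
  also have "\<dots> \<in> ideal_pow P k"
    using cl(2) cl(4)[OF power_in_ideal_pow[OF I p(1)]] cl(3)[OF assms(3)] by blast
  finally show ?thesis .
qed

text \<open>In a Noetherian ring the union of a nonempty chain of ideals is a member of the chain,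
  which supplies the upper bound for Zorn's lemma; the empty chain is bounded because
  \<open>\<S>\<close> is nonempty.\<close>

lemma noetherian_maximal_element:
  assumes "noetherian_ring R" "\<S> \<noteq> {}" "\<And>I. I \<in> \<S> \<Longrightarrow> ideal I R"
  obtains M where "M \<in> \<S>" "\<And>I. I \<in> \<S> \<Longrightarrow> M \<subseteq> I \<Longrightarrow> I = M"
proof -
  have "\<exists>U\<in>\<S>. \<forall>Y\<in>C. Y \<subseteq> U" if "subset.chain \<S> C" for C
  proof (cases "C = {}")
    case True
    then show ?thesis using assms(2) by auto
  next
    case False
    have "subset.chain {I. ideal I R} C"
      using that assms(3) by (auto simp: pred_on.chain_def)
    then have "\<Union>C \<in> C" using noetherian_ring.ideal_chain_is_trivial[OF assms(1) False] by blast
    moreover have "C \<subseteq> \<S>" using that by (simp add: pred_on.chain_def)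
    ultimately show ?thesis by (intro bexI[of _ "\<Union>C"]) auto
  qed
  from subset_Zorn[OF this] show ?thesis using that by blast
qed

text \<open>A maximal element among the ideals \<open>(b : c)\<close> contained in \<open>P\<close> is prime.\<close>

lemma dedekind_prime_colon:
  fixes P :: "'a::idom set"
  assumes D: "dedekind_domain TYPE('a)" and P: "primeideal P class_ring" and b: "b \<in> P" "b \<noteq> 0"
  obtains c where "P = {r. b dvd r * c}"
proof -
  have I: "ideal P class_ring" using P by (simp add: primeideal_def)
  define colon where "colon c = {r. b dvd r * c}" for c
  have colon: "ideal (colon c) class_ring" for c
    unfolding colon_def by (rule class_idealI) (auto simp: distrib_right mult.assoc)
  define \<S> where "\<S> = {colon c | c. colon c \<subseteq> P}"
  have "colon 1 \<subseteq> P" unfolding colon_def using class_ideal_mult_right[OF I b(1)] by (auto simp: dvd_def)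
  then have "colon 1 \<in> \<S>" unfolding \<S>_def by blast
  then have ne: "\<S> \<noteq> {}" by blast
  have "noetherian_ring (class_ring :: 'a ring)"
    using D by (simp add: dedekind_domain_def noetherian_domain_def)
  then obtain M where M: "M \<in> \<S>" "\<And>J. J \<in> \<S> \<Longrightarrow> M \<subseteq> J \<Longrightarrow> J = M"
    using noetherian_maximal_element[OF _ ne] colon unfolding \<S>_def by (smt (verit) mem_Collect_eq)
  then obtain c where c: "M = colon c" "colon c \<subseteq> P" unfolding \<S>_def by blast
  \<comment> \<open>Elements outside P are nonzerodivisors modulo \<open>colon c\<close>: replacing
    c by t c can only enlarge the colon ideal but keeps it inside P, so maximality forces
    equality.\<close>
  have cancel: "x \<in> colon c" if "t \<notin> P" "t * x \<in> colon c" for t x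
  proof -
    have sub: "colon (t * c) \<subseteq> P"
    proof
      fix r assume "r \<in> colon (t * c)"
      then have "r * t \<in> P" using c(2) by (auto simp: colon_def mult.assoc)
      then show "r \<in> P" using class_primeideal(2)[OF P] that(1) by blast
    qed
    moreover have "colon c \<subseteq> colon (t * c)" 
    proof
      fix r assume "r \<in> colon c"
      then have "b dvd t * (r * c)" by (simp add: colon_def)
      then show "r \<in> colon (t * c)" by (simp add: colon_def mult.left_commute)
    qed
    ultimately have "colon (t * c) = colon c" using M(2)[of "colon (t * c)"] c unfolding \<S>_def by blast
    moreover have "x \<in> colon (t * c)" using that(2) by (simp add: colon_def mult_ac)
    ultimately show ?thesis by simp
  qed
  have "primeideal (colon c) (class_ring :: 'a ring)"
  proof (rule primeidealI[OF colon class_cring.cring_axioms])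
    show "carrier (class_ring :: 'a ring) \<noteq> colon c" using c(2) class_primeideal(1)[OF P] by auto
  next
    fix x y :: 'a
    assume "x \<otimes>\<^bsub>class_ring\<^esub> y \<in> colon c"
    then have xy: "x * y \<in> colon c" by simp
    show "x \<in> colon c \<or> y \<in> colon c"
    proof (rule ccontr)
      assume n: "\<not> (x \<in> colon c \<or> y \<in> colon c)"
      have "colon c \<subseteq> colon (c * x)" unfolding colon_def by (auto simp flip: mult.assoc)
      moreover have "y \<in> colon (c * x)" using xy unfolding colon_def by (simp add: mult_ac)
      \<comment> \<open>The ideal \<open>colon (c * x)\<close> is strictly larger than
        \<open>colon c\<close>, since it contains y, so by maximality it has an element t outside P.
        Then t x lies in \<open>colon c\<close>, and cancelling t puts x there.\<close>
      ultimately have "\<not> colon (c * x) \<subseteq> P" using M(2)[of "colon (c * x)"] c n unfolding \<S>_def by blast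
      then obtain t where "t \<in> colon (c * x)" "t \<notin> P" by blast
      then show False using cancel[of t x] n unfolding colon_def by (simp add: mult_ac)
    qed
  qed
  moreover have "b \<in> colon c" by (simp add: colon_def)
  \<comment> \<open>The prime \<open>colon c\<close> contains b and so is nonzero, hence maximal;
    being contained in P, it equals P.\<close>
  ultimately have "maximalideal (colon c) (class_ring :: 'a ring)"
    using D b unfolding dedekind_domain_def by blast
  from maximalideal.I_maximal[OF this I c(2)] have "P = colon c"
    using class_primeideal(1)[OF P] by auto
  then show ?thesis using that unfolding colon_def by blast
qed

lemma genideal_class_eq_span:
  fixes g :: "nat \<Rightarrow> 'a::idom"
  shows "genideal class_ring (g ` {..<k}) = {\<Sum>i<k. r i * g i | r. True}" (is "_ = ?S")
proof
  have J: "ideal (genideal class_ring (g ` {..<k})) class_ring"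
    by (rule ring.genideal_ideal[OF class_ring.ring_axioms]) auto
  have g: "g ` {..<k} \<subseteq> genideal class_ring (g ` {..<k})"
    by (rule ring.genideal_self[OF class_ring.ring_axioms]) auto
  show "?S \<subseteq> genideal class_ring (g ` {..<k})"
  proof clarify
    fix r :: "nat \<Rightarrow> 'a"
    show "(\<Sum>i<k. r i * g i) \<in> genideal class_ring (g ` {..<k})"
      by (rule class_ideal_sum[OF J], rule class_ideal_mult[OF J]) (use g in auto)
  qed
  have "ideal ?S class_ring"
  proof (rule class_idealI)
    show "0 \<in> ?S" by (auto intro!: exI[of _ "\<lambda>_. 0"])
  next
    fix a b assume "a \<in> ?S" "b \<in> ?S"
    then obtain r r' where "a = (\<Sum>i<k. r i * g i)" "b = (\<Sum>i<k. r' i * g i)" by blast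
    then have "a + b = (\<Sum>i<k. (r i + r' i) * g i)" by (simp add: distrib_right sum.distrib)
    then show "a + b \<in> ?S" by (intro CollectI exI[of _ "\<lambda>i. r i + r' i"]) simp
  next
    fix s a assume "a \<in> ?S"
    then obtain r where "a = (\<Sum>i<k. r i * g i)" by blast
    then have "s * a = (\<Sum>i<k. (s * r i) * g i)" by (simp add: sum_distrib_left mult.assoc)
    then show "s * a \<in> ?S" by (intro CollectI exI[of _ "\<lambda>i. s * r i"]) simp
  qed
  moreover have "g ` {..<k} \<subseteq> ?S"
  proof clarify
    fix i assume "i < k"
    then have "g i = (\<Sum>j<k. (if j = i then 1 else 0) * g j)"
      by (simp add: if_distrib[of "\<lambda>x. x * _"] cong: if_cong)
    then show "\<exists>r. g i = (\<Sum>j<k. r j * g j) \<and> True"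
      by (intro exI[of _ "\<lambda>j. if j = i then 1 else 0"] conjI TrueI)
  qed
  ultimately show "genideal class_ring (g ` {..<k}) \<subseteq> ?S" by (rule ring.genideal_minimal[OF class_ring.ring_axioms])
qed

lemma noetherian_class_fin_gen:
  fixes J :: "'a::idom set"
  assumes "noetherian_domain (class_ring :: 'a ring)" "ideal J class_ring"
  obtains k and g :: "nat \<Rightarrow> 'a" where "\<And>i. i < k \<Longrightarrow> g i \<in> J" "J = {\<Sum>i<k. r i * g i | r. True}"
proof -
  obtain A where A: "finite A" "J = genideal class_ring A"
    using assms noetherian_ring.finetely_gen[of class_ring J] by (auto simp: noetherian_domain_def)
  obtain xs where xs: "set xs = A" using A(1) finite_list by blast
  have im: "(!) xs ` {..<length xs} = A" using xs by (auto simp: set_conv_nth)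
  have "xs ! i \<in> J" if "i < length xs" for i
    using ring.genideal_self[OF class_ring.ring_axioms, of A] xs nth_mem[OF that] A(2) by auto
  moreover have "J = {\<Sum>i<length xs. r i * xs ! i | r. True}"
    using genideal_class_eq_span[of "(!) xs" "length xs"] im A(2) by simp
  ultimately show ?thesis using that[of "length xs" "(!) xs"] by blast
qed

section \<open>Integrality, the inverse of a prime and local uniformizers\<close>

interpretation to_fract: inj_comm_ring_hom "to_fract :: 'a::idom \<Rightarrow> 'a fract"
  by unfold_locales auto

text \<open>The determinant trick: \<open>a\<close> is an eigenvalue of an integral matrix.\<close>

lemma dedekind_ideal_stable_imp_integral:
  fixes J :: "'a::idom set" and a :: "'a fract"
  assumes D: "dedekind_domain TYPE('a)" and J: "ideal J class_ring" "J \<noteq> {0}"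
    and a: "\<And>x. x \<in> J \<Longrightarrow> \<exists>y\<in>J. a * to_fract x = to_fract y"
  shows "a \<in> range to_fract"
proof -
  have N: "noetherian_domain (class_ring :: 'a ring)" using D by (simp add: dedekind_domain_def)
  obtain k and g :: "nat \<Rightarrow> 'a" where g: "\<And>i. i < k \<Longrightarrow> g i \<in> J" "J = {\<Sum>i<k. r i * g i | r. True}"
    using noetherian_class_fin_gen[OF N J(1)] by blast
  have "\<exists>r. a * to_fract (g i) = to_fract (\<Sum>j<k. r j * g j)" if "i < k" for i
    using a[OF g(1)[OF that]] g(2) by blast
  then obtain r where r: "\<And>i. i < k \<Longrightarrow> a * to_fract (g i) = to_fract (\<Sum>j<k. r i j * g j)" by metis
  define A where "A = mat k k (\<lambda>(i, j). r i j)"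
  have A: "A \<in> carrier_mat k k" by (simp add: A_def)
  define v where "v = vec k (\<lambda>i. to_fract (g i))"
  \<comment> \<open>An eigenvector has to be nonzero; this is what J \<noteq> {0} provides.\<close>
  have "\<exists>i<k. g i \<noteq> 0"
  proof (rule ccontr)
    assume "\<not> ?thesis"
    then have "J \<subseteq> {0}" unfolding g(2) by auto
    then show False using J class_ideal_zero[OF J(1)] by blast
  qed
  then have "v \<noteq> 0\<^sub>v k" unfolding v_def by (auto simp: vec_eq_iff)
  moreover have "map_mat to_fract A *\<^sub>v v = a \<cdot>\<^sub>v v"
    by (rule eq_vecI) (auto simp: A_def v_def r scalar_prod_def to_fract.hom_sum atLeast0LessThan)
  ultimately have "eigenvector (map_mat to_fract A) v a"
    unfolding eigenvector_def by (simp add: A_def v_def)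
  then have "poly (char_poly (map_mat to_fract A)) a = 0"
    using eigenvalue_root_char_poly[of "map_mat to_fract A" k a] A by (auto simp: eigenvalue_def)
  then have "poly (map_poly to_fract (char_poly A)) a = 0" using to_fract.char_poly_hom[OF A] by simp
  moreover have "Polynomial.lead_coeff (char_poly A) = 1" using degree_monic_char_poly[OF A] by simp
  ultimately show ?thesis using D unfolding dedekind_domain_def by blast
qed

text \<open>Writing P as the colon ideal (b : c), the fraction a = c/b multiplies y into R exactly
  when y lies in P. The case y = 1 shows that a is outside R. So a is an element of P^-1 that is not
  in R.\<close>

lemma dedekind_prime_inverse:
  fixes P :: "'a::idom set"
  assumes D: "dedekind_domain TYPE('a)" and P: "primeideal P class_ring" and P0: "P \<noteq> {0}"
  obtains a where "a \<notin> range to_fract" "\<And>y. y \<in> P \<Longrightarrow> a * to_fract y \<in> range to_fract"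
proof -
  have I: "ideal P class_ring" using P by (simp add: primeideal_def)
  obtain b where b: "b \<in> P" "b \<noteq> 0" using P0 class_ideal_zero[OF I] by blast
  obtain c where c: "P = {r. b dvd r * c}" using dedekind_prime_colon[OF D P b] .
  define a where "a = to_fract c / to_fract b"
  have *: "a * to_fract y \<in> range to_fract \<longleftrightarrow> y \<in> P" for y
  proof -
    have "a * to_fract y \<in> range to_fract \<longleftrightarrow> (\<exists>z. to_fract c * to_fract y = to_fract z * to_fract b)"
      using b(2) unfolding a_def by (auto simp: field_simps image_iff)
    also have "\<dots> \<longleftrightarrow> (\<exists>z. c * y = z * b)" by (metis to_fract_mult to_fract_eq_iff)
    also have "\<dots> \<longleftrightarrow> y \<in> P" unfolding c dvd_def by (auto simp: mult_ac)
    finally show ?thesis .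
  qed
  then show ?thesis using that[of a] *[of 1] class_primeideal(1)[OF P] by auto
qed

text \<open>Take a in P^-1 outside R. If a P were contained in P, then a would be integral and so in
  R; hence a \<pi> = s is outside P for some \<pi> in P. For y in P this gives s y = \<pi> (a y)
  with a y in R. The statement says that the localization at P has a principal maximal ideal,
  without forming the localization.\<close>

lemma dedekind_local_uniformizer:
  fixes P :: "'a::idom set"
  assumes D: "dedekind_domain TYPE('a)" and P: "primeideal P class_ring" and P0: "P \<noteq> {0}"
  obtains \<pi> s where "\<pi> \<in> P" "\<pi> \<noteq> 0" "s \<notin> P" "\<And>y. y \<in> P \<Longrightarrow> \<pi> dvd s * y"
proof -
  have I: "ideal P class_ring" using P by (simp add: primeideal_def)
  obtain a where a: "a \<notin> range to_fract" "\<And>y. y \<in> P \<Longrightarrow> a * to_fract y \<in> range to_fract"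
    using dedekind_prime_inverse[OF assms] by blast
  then obtain \<pi> s where ps: "\<pi> \<in> P" "a * to_fract \<pi> = to_fract s" "s \<notin> P"
    using dedekind_ideal_stable_imp_integral[OF D I P0, of a] by fastforce
  have "\<pi> \<noteq> 0" using ps class_ideal_zero[OF I] by auto
  moreover have "\<pi> dvd s * y" if y: "y \<in> P" for y
  proof -
    obtain z where z: "a * to_fract y = to_fract z" using a(2)[OF y] by blast
    have "to_fract (s * y) = to_fract (\<pi> * z)" by (simp add: ps(2)[symmetric] z[symmetric])
    then show ?thesis unfolding to_fract_eq_iff by simp
  qed
  ultimately show ?thesis using that ps by blast
qed

text \<open>Up to s, the ideal P is generated by \<pi>, so each factor taken from P yields one \<pi>
  at the cost of one s. The claim passes from products to their sums, which make up the next
  power.\<close>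

lemma ideal_pow_dvd:
  fixes P :: "'a::idom set"
  assumes I: "ideal P class_ring" and \<pi>: "\<And>y. y \<in> P \<Longrightarrow> \<pi> dvd s * y" and "y \<in> ideal_pow P k"
  shows "\<pi> ^ k dvd s ^ k * y"
  using assms(3)
proof (induction k arbitrary: y)
  case (Suc k)
  from Suc.prems show ?case unfolding ideal_pow_Suc
  proof (induction rule: ideal_prod.induct)
    case (prod i j)
    then have "\<pi> ^ k * \<pi> dvd (s ^ k * i) * (s * j)" using Suc.IH \<pi> by (intro mult_dvd_mono)
    then show ?case by (simp add: mult_ac)
  next
    case (sum y z)
    then show ?case by (simp add: distrib_left)
  qed
qed simp

text \<open>In terms of the valuation at P, \<pi> has valuation exactly 1. Multiplying by s^(k+1)
  and cancelling \<pi>^k shows that \<pi> divides s^(k+1) y, which therefore lies in P, and no power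
  of s does.\<close>

lemma uniformizer_power_cancel:
  fixes P :: "'a::idom set"
  assumes P: "primeideal P class_ring" and \<pi>: "\<pi> \<in> P" "\<pi> \<noteq> 0" "s \<notin> P"
    "\<And>y. y \<in> P \<Longrightarrow> \<pi> dvd s * y" and y: "\<pi> ^ k * y \<in> ideal_pow P (k + 1)"
  shows "y \<in> P"
proof -
  have I: "ideal P class_ring" using P by (simp add: primeideal_def)
  have "\<pi> ^ (k + 1) dvd s ^ (k + 1) * (\<pi> ^ k * y)" by (rule ideal_pow_dvd[OF I \<pi>(4) y])
  then have "\<pi> ^ k * \<pi> dvd \<pi> ^ k * (s ^ (k + 1) * y)" by (simp add: mult_ac)
  then have "\<pi> dvd s ^ (k + 1) * y" using \<pi>(2) by (metis dvd_mult_cancel_left power_not_zero)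
  then have "s ^ (k + 1) * y \<in> P" using class_ideal_mult_right[OF I \<pi>(1)] unfolding dvd_def by auto
  then show ?thesis using class_primeideal(2)[OF P] class_prime_power[OF P \<pi>(3)] by blast
qed

section \<open>Reduction of polynomials modulo an ideal\<close>

text \<open>For an ideal I this is the ideal I[x] of R[x], the kernel of the reduction to (R/I)[x].
  Congruences modulo it stand in for computations over the residue ring.\<close>

definition coeffs_in :: "'a::idom set \<Rightarrow> 'a poly set" where
  "coeffs_in I = {f. \<forall>i. Polynomial.coeff f i \<in> I}"

lemma ideal_coeffs_in:
  fixes I :: "'a::idom set"
  assumes "ideal I class_ring"
  shows "ideal (coeffs_in I) class_ring"
  using class_ideal_zero[OF assms] class_ideal_add[OF assms]
  by (intro class_idealI)
    (auto simp: coeffs_in_def coeff_mult intro!: class_ideal_sum[OF assms] class_ideal_mult[OF assms])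

text \<open>Let i be the last index at which g has a coefficient outside I, and d the degree of f.
  In coefficient d + i of f g that coefficient meets the leading 1 of f, while every other term has
  a coefficient of g beyond i or a vanishing coefficient of f. This is what permits division by
  \<phi> in congruences.\<close>

lemma monic_cancel_coeffs_in:
  fixes I :: "'a::idom set"
  assumes I: "ideal I class_ring" and f: "Polynomial.lead_coeff f = 1" and fg: "f * g \<in> coeffs_in I"
  shows "g \<in> coeffs_in I"
proof (rule ccontr)
  assume "g \<notin> coeffs_in I"
  then obtain k where k: "Polynomial.coeff g k \<notin> I" by (auto simp: coeffs_in_def)
  have bound: "j \<le> Polynomial.degree g" if "Polynomial.coeff g j \<notin> I" for j
    using that class_ideal_zero[OF I] by (metis coeff_eq_0 not_le)
  obtain i where i: "Polynomial.coeff g i \<notin> I" "\<And>j. Polynomial.coeff g j \<notin> I \<Longrightarrow> j \<le> i"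
    using GreatestI_nat[of "\<lambda>j. Polynomial.coeff g j \<notin> I", OF k bound]
      Greatest_le_nat[of "\<lambda>j. Polynomial.coeff g j \<notin> I", OF _ bound] by blast
  define d where "d = Polynomial.degree f"
  have "Polynomial.coeff (f * g) (d + i) =
      (\<Sum>k\<le>d + i. Polynomial.coeff f k * Polynomial.coeff g (d + i - k))" by (rule coeff_mult)
  also have "\<dots> = Polynomial.coeff g i +
      (\<Sum>k\<in>{..d + i} - {d}. Polynomial.coeff f k * Polynomial.coeff g (d + i - k))"
    by (subst sum.remove[of _ d]) (use f in \<open>auto simp: d_def\<close>)
  finally have eq: "Polynomial.coeff g i = Polynomial.coeff (f * g) (d + i) -
      (\<Sum>k\<in>{..d + i} - {d}. Polynomial.coeff f k * Polynomial.coeff g (d + i - k))" by simp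
  have "Polynomial.coeff f k * Polynomial.coeff g (d + i - k) \<in> I"
    if "k \<in> {..d + i} - {d}" for k
  proof (cases "k < d")
    case True
    then have "Polynomial.coeff g (d + i - k) \<in> I" using i(2)[of "d + i - k"] by linarith
    then show ?thesis by (rule class_ideal_mult[OF I])
  next
    case False
    then show ?thesis using that class_ideal_zero[OF I] by (simp add: d_def coeff_eq_0)
  qed
  moreover have "Polynomial.coeff (f * g) (d + i) \<in> I" using fg by (simp add: coeffs_in_def)
  ultimately have "Polynomial.coeff g i \<in> I"
    unfolding eq by (intro class_ideal_diff[OF I] class_ideal_sum[OF I])
  then show False using i(1) by contradiction
qed

lemma class_coset_eq_iff:
  fixes I :: "'a::idom set"
  assumes "ideal I class_ring"
  shows "I +>\<^bsub>class_ring\<^esub> a = I +>\<^bsub>class_ring\<^esub> b \<longleftrightarrow> a - b \<in> I"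
proof
  have coset: "I +>\<^bsub>class_ring\<^esub> c = {x + c | x. x \<in> I}" for c
    by (auto simp: a_r_coset_def')
  note cl = class_ideal[OF assms]
  show "a - b \<in> I" if "I +>\<^bsub>class_ring\<^esub> a = I +>\<^bsub>class_ring\<^esub> b"
  proof -
    have "a \<in> I +>\<^bsub>class_ring\<^esub> a" unfolding coset using cl(1) by force
    then have "a \<in> I +>\<^bsub>class_ring\<^esub> b" using that by simp
    then obtain x where "a = x + b" "x \<in> I" unfolding coset by blast
    then show ?thesis by simp
  qed
  show "I +>\<^bsub>class_ring\<^esub> a = I +>\<^bsub>class_ring\<^esub> b" if ab: "a - b \<in> I"
  proof -
    have "x + a = (x + (a - b)) + b" "x + b = (x - (a - b)) + a" for x by simp_all
    then show ?thesis unfolding coset using cl(2,6) ab by blast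
  qed
qed

lemma reduce_poly_in_carrier:
  fixes I :: "'a::idom set"
  assumes I: "ideal I class_ring"
  shows "reduce_poly I f \<in> carrier (poly_ring (residue_field I))"
proof -
  interpret I: ideal I "class_ring :: 'a ring" by (rule I)
  interpret Q: ring "residue_field I" by (rule I.quotient_is_ring)
  interpret h: ring_hom_ring "class_ring :: 'a ring" "residue_field I" "(+>\<^bsub>class_ring\<^esub>) I"
    by (rule I.rcos_ring_hom_ring)
  have "I +>\<^bsub>class_ring\<^esub> c \<in> carrier (residue_field I)" for c using h.hom_closed[of c] by simp
  then have "set (map (\<lambda>c. I +>\<^bsub>class_ring\<^esub> c) (rev (coeffs f))) \<subseteq> carrier (residue_field I)" by auto
  from Q.normalize_gives_polynomial[OF this] show ?thesis
    unfolding reduce_poly_def univ_poly_carrier .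
qed

text \<open>Dropping leading zeros by \<open>ring.normalize\<close> does not change coefficients,
  and beyond the length of the list both sides are the zero coset.\<close>

lemma coeff_reduce_poly:
  fixes I :: "'a::idom set"
  assumes I: "ideal I class_ring"
  shows "ring.coeff (residue_field I) (reduce_poly I f) i = I +>\<^bsub>class_ring\<^esub> Polynomial.coeff f i"
proof -
  interpret I: ideal I "class_ring :: 'a ring" by (rule I)
  interpret Q: ring "residue_field I" by (rule I.quotient_is_ring)
  interpret h: ring_hom_ring "class_ring :: 'a ring" "residue_field I" "(+>\<^bsub>class_ring\<^esub>) I"
    by (rule I.rcos_ring_hom_ring)
  let ?l = "map (\<lambda>c. I +>\<^bsub>class_ring\<^esub> c) (rev (coeffs f))"
  have "Q.coeff (reduce_poly I f) i = Q.coeff ?l i"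
    unfolding reduce_poly_def using Q.normalize_coeff by metis
  also have "\<dots> = I +>\<^bsub>class_ring\<^esub> Polynomial.coeff f i"
  proof (cases "i < length (coeffs f)")
    case True
    then show ?thesis
      by (subst Q.coeff_nth) (auto simp: rev_nth nth_coeffs_coeff)
  next
    case False
    then have "Q.coeff ?l i = \<zero>\<^bsub>residue_field I\<^esub>" by (intro Q.coeff_length) simp
    moreover have "Polynomial.coeff f i = 0" using False
      by (metis coeffs_nth coeff_eq_0 length_coeffs_degree less_Suc_eq_le not_le coeff_0)
    ultimately show ?thesis using h.hom_zero by simp
  qed
  finally show ?thesis .
qed

text \<open>Normalized lists are determined by their coefficient functions. This translates between
  equality over the residue ring and congruence in R[x].\<close>

lemma reduce_poly_eq_iff:
  fixes I :: "'a::idom set"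
  assumes I: "ideal I class_ring"
  shows "reduce_poly I f = reduce_poly I g \<longleftrightarrow> f - g \<in> coeffs_in I"
proof -
  interpret I: ideal I "class_ring :: 'a ring" by (rule I)
  interpret Q: ring "residue_field I" by (rule I.quotient_is_ring)
  have "reduce_poly I f = reduce_poly I g \<longleftrightarrow> Q.coeff (reduce_poly I f) = Q.coeff (reduce_poly I g)"
    using reduce_poly_in_carrier[OF I]
    by (intro Q.coeff_iff_polynomial_cond[of "carrier (residue_field I)"]) (auto simp: univ_poly_carrier)
  also have "\<dots> \<longleftrightarrow> f - g \<in> coeffs_in I"
    by (simp add: fun_eq_iff coeff_reduce_poly[OF I] class_coset_eq_iff[OF I] coeffs_in_def)
  finally show ?thesis .
qed

lemma reduce_poly_mult:
  fixes I :: "'a::idom set"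
  assumes I: "ideal I class_ring"
  shows "reduce_poly I (f * g) = reduce_poly I f \<otimes>\<^bsub>poly_ring (residue_field I)\<^esub> reduce_poly I g"
proof -
  interpret I: ideal I "class_ring :: 'a ring" by (rule I)
  interpret Q: ring "residue_field I" by (rule I.quotient_is_ring)
  interpret h: ring_hom_ring "class_ring :: 'a ring" "residue_field I" "(+>\<^bsub>class_ring\<^esub>) I"
    by (rule I.rcos_ring_hom_ring)
  note carr = reduce_poly_in_carrier[OF I]
  have set: "set (reduce_poly I p) \<subseteq> carrier (residue_field I)" for p
    using carr[of p] Q.polynomial_incl unfolding univ_poly_carrier[symmetric] by blast
  have hom: "I +>\<^bsub>class_ring\<^esub> a \<in> carrier (residue_field I)"
    "I +>\<^bsub>class_ring\<^esub> (a * b) = (I +>\<^bsub>class_ring\<^esub> a) \<otimes>\<^bsub>residue_field I\<^esub> (I +>\<^bsub>class_ring\<^esub> b)" for a b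
    using h.hom_closed[of a] h.hom_mult[of a b] by simp_all
  let ?r = "reduce_poly I"
  have "Q.coeff (?r (f * g)) i = Q.coeff (?r f \<otimes>\<^bsub>poly_ring (residue_field I)\<^esub> ?r g) i" for i
  proof -
    let ?c = "\<lambda>k. Polynomial.coeff f k * Polynomial.coeff g (i - k)"
    have "Q.coeff (?r f \<otimes>\<^bsub>poly_ring (residue_field I)\<^esub> ?r g) i =
        (\<Oplus>\<^bsub>residue_field I\<^esub>k\<in>{..i}. Q.coeff (?r f) k \<otimes>\<^bsub>residue_field I\<^esub> Q.coeff (?r g) (i - k))"
      unfolding univ_poly_mult using Q.poly_mult_coeff[OF set set] by simp
    also have "\<dots> = (\<Oplus>\<^bsub>residue_field I\<^esub>k\<in>{..i}. I +>\<^bsub>class_ring\<^esub> ?c k)"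
      by (intro Q.finsum_cong') (auto simp: coeff_reduce_poly[OF I] hom)
    also have "\<dots> = I +>\<^bsub>class_ring\<^esub> (\<Oplus>\<^bsub>class_ring\<^esub>k\<in>{..i}. ?c k)"
      using h.hom_finsum[of ?c "{..i}"] by (simp add: comp_def)
    also have "\<dots> = I +>\<^bsub>class_ring\<^esub> Polynomial.coeff (f * g) i"
      by (simp add: class_ring_simps coeff_mult)
    finally show ?thesis by (simp add: coeff_reduce_poly[OF I])
  qed
  then show ?thesis
    using carr[of "f * g"] Q.poly_mult_is_polynomial[OF Q.carrier_is_subring set set]
    by (subst Q.coeff_iff_polynomial_cond[of "carrier (residue_field I)"])
      (auto simp: univ_poly_carrier univ_poly_mult)
qed

section \<open>Divisibility by the approximate square root\<close>

context field
begin

abbreviation "FX \<equiv> poly_ring R"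

lemma univ_poly_domain: "domain FX"
  by (rule univ_poly_is_domain[OF carrier_is_subring])

lemma pdividesI: "c \<in> carrier FX \<Longrightarrow> q = p \<otimes>\<^bsub>FX\<^esub> c \<Longrightarrow> p pdivides q"
  unfolding pdivides_def factor_def by blast

lemma pdividesE:
  assumes "p pdivides q" obtains c where "c \<in> carrier FX" "q = p \<otimes>\<^bsub>FX\<^esub> c"
  using assms unfolding pdivides_def factor_def by blast

text \<open>The multiplicity of p in x^2 is twice that in x, so p occurs in x at least ceil(d/2) = d
  - d div 2 times. Instead of multiplicities, the induction uses that the prime p divides x and
  cancels p^2 from both sides, which lowers d by two.\<close>

lemma pirreducible_pow_pdivides_square:
  assumes p: "p \<in> carrier FX" "pirreducible (carrier R) p"
    and "x \<in> carrier FX" "(p [^]\<^bsub>FX\<^esub> d) pdivides (x \<otimes>\<^bsub>FX\<^esub> x)"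
  shows "(p [^]\<^bsub>FX\<^esub> (d - d div 2 :: nat)) pdivides x"
  using assms(3,4)
proof (induction d arbitrary: x rule: less_induct)
  case (less d)
  interpret UP: domain FX by (rule univ_poly_domain)
  note x = less.prems(1)
  have p0: "p \<noteq> \<zero>\<^bsub>FX\<^esub>" using pirreducibleE(1)[OF carrier_is_subring p] by (simp add: univ_poly_zero)
  show ?case
  proof (cases d)
    case 0
    then show ?thesis using x by (auto intro: pdividesI[of x])
  next
    case (Suc d')
    obtain c where c: "c \<in> carrier FX" "x \<otimes>\<^bsub>FX\<^esub> x = p [^]\<^bsub>FX\<^esub> d \<otimes>\<^bsub>FX\<^esub> c"
      using less.prems(2) by (rule pdividesE)
    then have "x \<otimes>\<^bsub>FX\<^esub> x = p \<otimes>\<^bsub>FX\<^esub> (p [^]\<^bsub>FX\<^esub> d' \<otimes>\<^bsub>FX\<^esub> c)"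
      using p by (simp add: Suc UP.m_ac)
    then have "p pdivides (x \<otimes>\<^bsub>FX\<^esub> x)" using p c by (intro pdividesI[of "p [^]\<^bsub>FX\<^esub> d' \<otimes>\<^bsub>FX\<^esub> c"]) auto
    moreover have "pprime (carrier R) p" using pprime_iff_pirreducible[OF carrier_is_subfield p(1)] p(2) by simp
    ultimately have "p pdivides x" using pprimeE(3)[OF carrier_is_subfield p(1)] x by blast
    then obtain y where y: "y \<in> carrier FX" "x = p \<otimes>\<^bsub>FX\<^esub> y" by (rule pdividesE)
    show ?thesis
    proof (cases d')
      case 0
      then show ?thesis using Suc y p by (auto intro: pdividesI[of y])
    next
      case (Suc k)
      have dk: "d = Suc (Suc k)" using \<open>d = Suc d'\<close> Suc by simp
      have "(p \<otimes>\<^bsub>FX\<^esub> p) \<otimes>\<^bsub>FX\<^esub> (y \<otimes>\<^bsub>FX\<^esub> y) = x \<otimes>\<^bsub>FX\<^esub> x"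
        unfolding y(2) using y(1) p(1) by (simp add: UP.m_ac)
      also have "\<dots> = (p \<otimes>\<^bsub>FX\<^esub> p) \<otimes>\<^bsub>FX\<^esub> (p [^]\<^bsub>FX\<^esub> k \<otimes>\<^bsub>FX\<^esub> c)"
        unfolding c(2) using c(1) p(1) by (simp add: dk UP.m_ac)
      finally have "y \<otimes>\<^bsub>FX\<^esub> y = p [^]\<^bsub>FX\<^esub> k \<otimes>\<^bsub>FX\<^esub> c"
        using p(1) p0 c(1) y(1) UP.m_lcancel[of "p \<otimes>\<^bsub>FX\<^esub> p" "y \<otimes>\<^bsub>FX\<^esub> y" "p [^]\<^bsub>FX\<^esub> k \<otimes>\<^bsub>FX\<^esub> c"]
        by (simp add: UP.integral_iff)
      then have "(p [^]\<^bsub>FX\<^esub> (k - k div 2)) pdivides y"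
        using c y dk by (intro less.IH) (auto intro: pdividesI[of c])
      then obtain z where z: "z \<in> carrier FX" "y = p [^]\<^bsub>FX\<^esub> (k - k div 2) \<otimes>\<^bsub>FX\<^esub> z" by (rule pdividesE)
      have "d - d div 2 = Suc (k - k div 2)" using dk by simp
      then have "x = p [^]\<^bsub>FX\<^esub> (d - d div 2) \<otimes>\<^bsub>FX\<^esub> z"
        unfolding y(2) z(2) using z(1) p(1) by (simp add: UP.m_ac)
      then show ?thesis using z(1) by (intro pdividesI[of z])
    qed
  qed
qed

text \<open>An irreducible divisor of an irreducible polynomial is an associate, so the two differ
  by a constant, and comparing leading coefficients makes it 1. This turns distinctness of the monic
  factors into pairwise non-divisibility.\<close>

lemma monic_pirreducible_pdivides_eq:
  assumes p: "p \<in> carrier FX" "pirreducible (carrier R) p" "hd p = \<one>"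
    and q: "q \<in> carrier FX" "pirreducible (carrier R) q" "hd q = \<one>" and "p pdivides q"
  shows "p = q"
proof -
  interpret UP: domain FX by (rule univ_poly_domain)
  have "p \<notin> Units FX" "q \<noteq> []" using pirreducibleE[OF carrier_is_subring] p q by blast+
  then have "p \<sim>\<^bsub>FX\<^esub> q"
    using divides_pirreducible_condition[OF q(2) p(1)] \<open>p pdivides q\<close> by (simp add: pdivides_def)
  then obtain k where k: "k \<in> carrier R - {\<zero>}" "p = [k] \<otimes>\<^bsub>FX\<^esub> q"
    using associated_polynomials_iff[OF carrier_is_subfield p(1) q(1)] by blast
  have "polynomial (carrier R) [k]" "polynomial (carrier R) q"
    using const_is_polynomial[OF k(1)] q(1) by (simp_all add: univ_poly_carrier)
  then have "hd p = k \<otimes> hd q"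
    using poly_mult_lead_coeff[OF carrier_is_subring, of "[k]" q] \<open>q \<noteq> []\<close> k(2)
    by (simp add: univ_poly_mult)
  then have "k = \<one>" using p(3) q(3) k(1) by simp
  then show ?thesis using k(2) q(1) univ_poly_one[of R "carrier R"] UP.l_one by metis
qed

text \<open>Irreducible polynomials over a field are prime, so the polynomials not divisible by p
  are closed under products; 1 is among them because p is not a unit.\<close>

lemma not_pdivides_finprod_pow:
  assumes p: "p \<in> carrier FX" "pirreducible (carrier R) p"
    and "finite S" "\<And>i. i \<in> S \<Longrightarrow> \<gamma> i \<in> carrier FX" "\<And>i. i \<in> S \<Longrightarrow> \<not> p pdivides (\<gamma> i)"
  shows "\<not> p pdivides (\<Otimes>\<^bsub>FX\<^esub>i\<in>S. \<gamma> i [^]\<^bsub>FX\<^esub> (d i :: nat))"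
proof -
  interpret UP: domain FX by (rule univ_poly_domain)
  have pp: "pprime (carrier R) p" using pprime_iff_pirreducible[OF carrier_is_subfield p(1)] p(2) by simp
  note prime = pprimeE(3)[OF carrier_is_subfield p(1) pp]
  have one: "\<not> p pdivides \<one>\<^bsub>FX\<^esub>"
  proof
    assume "p pdivides \<one>\<^bsub>FX\<^esub>"
    then have "p \<in> Units FX" using p(1) UP.Units_one_closed UP.divides_unit pdivides_def by metis
    then show False using pirreducibleE(2)[OF carrier_is_subring p] by blast
  qed
  have pow: "\<not> p pdivides (q [^]\<^bsub>FX\<^esub> k)" if "q \<in> carrier FX" "\<not> p pdivides q" for q and k :: nat
    using that prime[OF UP.nat_pow_closed[OF that(1)] that(1)] by (induction k) (auto simp: one)
  show ?thesis using assms(3-5)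
  proof (induction S rule: finite_induct)
    case empty
    then show ?case using one by simp
  next
    case (insert i S)
    have eq: "(\<Otimes>\<^bsub>FX\<^esub>j\<in>insert i S. \<gamma> j [^]\<^bsub>FX\<^esub> d j) = \<gamma> i [^]\<^bsub>FX\<^esub> d i \<otimes>\<^bsub>FX\<^esub> (\<Otimes>\<^bsub>FX\<^esub>j\<in>S. \<gamma> j [^]\<^bsub>FX\<^esub> d j)"
      using insert by (intro UP.finprod_insert) auto
    have c1: "\<gamma> i [^]\<^bsub>FX\<^esub> d i \<in> carrier FX" using insert.prems(1)[of i] by simp
    have c2: "(\<Otimes>\<^bsub>FX\<^esub>j\<in>S. \<gamma> j [^]\<^bsub>FX\<^esub> d j) \<in> carrier FX"
      using insert.prems(1) by (intro UP.finprod_closed) auto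
    have "\<not> p pdivides (\<gamma> i [^]\<^bsub>FX\<^esub> d i)" by (rule pow) (use insert.prems in auto)
    moreover have "\<not> p pdivides (\<Otimes>\<^bsub>FX\<^esub>j\<in>S. \<gamma> j [^]\<^bsub>FX\<^esub> d j)"
      by (rule insert.IH) (use insert.prems in auto)
    ultimately show ?case unfolding eq using prime[OF c1 c2] by blast
  qed
qed

text \<open>Coprime divisors multiply: if x = D c, where D is the product over the earlier factors,
  then the new factor does not divide D, so its power has to divide c.\<close>

lemma finprod_pow_pdivides:
  assumes "finite S" "\<And>i. i \<in> S \<Longrightarrow> \<gamma> i \<in> carrier FX" "\<And>i. i \<in> S \<Longrightarrow> pirreducible (carrier R) (\<gamma> i)"
    "\<And>i j. i \<in> S \<Longrightarrow> j \<in> S \<Longrightarrow> i \<noteq> j \<Longrightarrow> \<not> \<gamma> i pdivides \<gamma> j"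
    "x \<in> carrier FX" "\<And>i. i \<in> S \<Longrightarrow> (\<gamma> i [^]\<^bsub>FX\<^esub> (d i :: nat)) pdivides x"
  shows "(\<Otimes>\<^bsub>FX\<^esub>i\<in>S. \<gamma> i [^]\<^bsub>FX\<^esub> d i) pdivides x"
  using assms
proof (induction S rule: finite_induct)
  case empty
  interpret UP: domain FX by (rule univ_poly_domain)
  have "x \<in> carrier FX" by (rule empty.prems(4))
  then show ?case by (intro pdividesI[of x]) simp_all
next
  case (insert i S)
  interpret UP: domain FX by (rule univ_poly_domain)
  let ?D = "\<Otimes>\<^bsub>FX\<^esub>j\<in>S. \<gamma> j [^]\<^bsub>FX\<^esub> d j"
  have D: "?D \<in> carrier FX" using insert.prems(1) by (intro UP.finprod_closed) auto
  have "?D pdivides x" by (rule insert.IH) (simp_all add: insert.prems)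
  then obtain c where c: "c \<in> carrier FX" "x = ?D \<otimes>\<^bsub>FX\<^esub> c" by (rule pdividesE)
  have nd: "\<not> \<gamma> i pdivides ?D" 
  proof (rule not_pdivides_finprod_pow)
    show "\<not> \<gamma> i pdivides \<gamma> j" if "j \<in> S" for j using insert.prems(3)[of i j] insert.hyps that by auto
  qed (simp_all add: insert.prems insert.hyps)
  have "(\<gamma> i [^]\<^bsub>FX\<^esub> d i) pdivides (?D \<otimes>\<^bsub>FX\<^esub> c)" using insert.prems(5)[of i] c by simp
  then have "(\<gamma> i [^]\<^bsub>FX\<^esub> d i) pdivides c"
    using pirreducible_pow_pdivides_iff[OF carrier_is_subfield _ D c(1) _ nd] insert.prems by simp
  then obtain e where e: "e \<in> carrier FX" "c = \<gamma> i [^]\<^bsub>FX\<^esub> d i \<otimes>\<^bsub>FX\<^esub> e" by (rule pdividesE)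
  have g: "\<gamma> i [^]\<^bsub>FX\<^esub> d i \<in> carrier FX" using insert.prems by simp
  have "(\<Otimes>\<^bsub>FX\<^esub>j\<in>insert i S. \<gamma> j [^]\<^bsub>FX\<^esub> d j) = \<gamma> i [^]\<^bsub>FX\<^esub> d i \<otimes>\<^bsub>FX\<^esub> ?D"
    using insert.prems(1) insert.hyps by (intro UP.finprod_insert) auto
  moreover have "x = (\<gamma> i [^]\<^bsub>FX\<^esub> d i \<otimes>\<^bsub>FX\<^esub> ?D) \<otimes>\<^bsub>FX\<^esub> e"
    unfolding c(2) e(2) using D e(1) g by (simp add: UP.m_ac)
  ultimately show ?case using e(1) by (intro pdividesI[of e]) simp_all
qed

lemma pow_pdivides_finprod_pow:
  assumes "finite S" "\<And>i. i \<in> S \<Longrightarrow> \<gamma> i \<in> carrier FX" "i \<in> S"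
  shows "(\<gamma> i [^]\<^bsub>FX\<^esub> (d i :: nat)) pdivides (\<Otimes>\<^bsub>FX\<^esub>j\<in>S. \<gamma> j [^]\<^bsub>FX\<^esub> d j)"
proof -
  interpret UP: domain FX by (rule univ_poly_domain)
  have "(\<Otimes>\<^bsub>FX\<^esub>j\<in>insert i (S - {i}). \<gamma> j [^]\<^bsub>FX\<^esub> d j) =
      \<gamma> i [^]\<^bsub>FX\<^esub> d i \<otimes>\<^bsub>FX\<^esub> (\<Otimes>\<^bsub>FX\<^esub>j\<in>S - {i}. \<gamma> j [^]\<^bsub>FX\<^esub> d j)"
    using assms by (intro UP.finprod_insert) auto
  moreover have "(\<Otimes>\<^bsub>FX\<^esub>j\<in>S - {i}. \<gamma> j [^]\<^bsub>FX\<^esub> d j) \<in> carrier FX"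
    using assms by (intro UP.finprod_closed) auto
  ultimately show ?thesis using assms(3) by (auto simp: insert_absorb intro!: pdividesI)
qed

text \<open>At each factor, x contributes at least ceil(d/2) and the product of halves at least
  floor(d/2), which add up to d. The contributions of different factors combine because distinct
  monic irreducibles do not divide each other.\<close>

lemma finprod_pow_pdivides_halves_mult:
  assumes S: "finite S" "\<And>i. i \<in> S \<Longrightarrow> \<gamma> i \<in> carrier FX" "\<And>i. i \<in> S \<Longrightarrow> pirreducible (carrier R) (\<gamma> i)"
    "\<And>i. i \<in> S \<Longrightarrow> hd (\<gamma> i) = \<one>" "inj_on \<gamma> S"
    and x: "x \<in> carrier FX" "(\<Otimes>\<^bsub>FX\<^esub>i\<in>S. \<gamma> i [^]\<^bsub>FX\<^esub> (d i :: nat)) pdivides (x \<otimes>\<^bsub>FX\<^esub> x)"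
  shows "(\<Otimes>\<^bsub>FX\<^esub>i\<in>S. \<gamma> i [^]\<^bsub>FX\<^esub> d i) pdivides ((\<Otimes>\<^bsub>FX\<^esub>i\<in>S. \<gamma> i [^]\<^bsub>FX\<^esub> (d i div 2)) \<otimes>\<^bsub>FX\<^esub> x)"
proof (rule finprod_pow_pdivides)
  interpret UP: domain FX by (rule univ_poly_domain)
  let ?G = "\<Otimes>\<^bsub>FX\<^esub>i\<in>S. \<gamma> i [^]\<^bsub>FX\<^esub> (d i div 2)"
  have G: "?G \<in> carrier FX" using S by (intro UP.finprod_closed) auto
  then show "?G \<otimes>\<^bsub>FX\<^esub> x \<in> carrier FX" using x by simp
  show "\<not> \<gamma> i pdivides \<gamma> j" if "i \<in> S" "j \<in> S" "i \<noteq> j" for i j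
    using monic_pirreducible_pdivides_eq[of "\<gamma> i" "\<gamma> j"] S(2-4)[OF that(1)] S(2-4)[OF that(2)]
      inj_onD[OF S(5) _ that(1,2)] that(3) by blast
  show "(\<gamma> i [^]\<^bsub>FX\<^esub> d i) pdivides (?G \<otimes>\<^bsub>FX\<^esub> x)" if i: "i \<in> S" for i
  proof -
    have D: "(\<gamma> i [^]\<^bsub>FX\<^esub> d i) pdivides (\<Otimes>\<^bsub>FX\<^esub>i\<in>S. \<gamma> i [^]\<^bsub>FX\<^esub> d i)"
      by (rule pow_pdivides_finprod_pow[OF S(1,2) i])
    then have "(\<gamma> i [^]\<^bsub>FX\<^esub> d i) pdivides (x \<otimes>\<^bsub>FX\<^esub> x)"
      using x S(2)[OF i] UP.divides_trans[of "\<gamma> i [^]\<^bsub>FX\<^esub> d i"] unfolding pdivides_def by blast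
    from pirreducible_pow_pdivides_square[OF S(2,3)[OF i] x(1) this]
    obtain c where c: "c \<in> carrier FX" "x = \<gamma> i [^]\<^bsub>FX\<^esub> (d i - d i div 2) \<otimes>\<^bsub>FX\<^esub> c" by (rule pdividesE)
    have "(\<gamma> i [^]\<^bsub>FX\<^esub> (d i div 2)) pdivides ?G"
      by (rule pow_pdivides_finprod_pow[OF S(1,2) i])
    then obtain b where b: "b \<in> carrier FX" "?G = \<gamma> i [^]\<^bsub>FX\<^esub> (d i div 2) \<otimes>\<^bsub>FX\<^esub> b" by (rule pdividesE)
    have "d i = d i div 2 + (d i - d i div 2)" by simp
    then have pw: "\<gamma> i [^]\<^bsub>FX\<^esub> d i = \<gamma> i [^]\<^bsub>FX\<^esub> (d i div 2) \<otimes>\<^bsub>FX\<^esub> \<gamma> i [^]\<^bsub>FX\<^esub> (d i - d i div 2)"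
      using UP.nat_pow_mult[OF S(2)[OF i]] by metis
    have "?G \<otimes>\<^bsub>FX\<^esub> x = (\<gamma> i [^]\<^bsub>FX\<^esub> (d i div 2) \<otimes>\<^bsub>FX\<^esub> b) \<otimes>\<^bsub>FX\<^esub> (\<gamma> i [^]\<^bsub>FX\<^esub> (d i - d i div 2) \<otimes>\<^bsub>FX\<^esub> c)"
      by (simp only: b(2) c(2)[symmetric])
    also have "\<dots> = \<gamma> i [^]\<^bsub>FX\<^esub> d i \<otimes>\<^bsub>FX\<^esub> (b \<otimes>\<^bsub>FX\<^esub> c)"
      unfolding pw using b(1) c(1) S(2)[OF i] by (simp add: UP.m_ac)
    finally show ?thesis using b(1) c(1) by (intro pdividesI[of "b \<otimes>\<^bsub>FX\<^esub> c"]) auto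
  qed
qed (use S in auto)

end

text \<open>The preceding divisibility, brought back to congruences modulo P[x] for use with x an
  entry of adj(x - M) u. The witness c is a lift of the quotient found over the residue
  field.\<close>

lemma approx_sqrt_mult:
  fixes P :: "'a::idom set"
  assumes P: "maximalideal P class_ring" and \<Gamma>: "is_approx_sqrt P M \<Gamma>" "reduce_poly P g = \<Gamma>"
    and x: "x * x - char_poly M * b \<in> coeffs_in P"
  obtains c where "g * x - char_poly M * c \<in> coeffs_in P"
proof -
  have I: "ideal P class_ring" using P by (simp add: maximalideal_def)
  interpret F: field "residue_field P"
    by (rule maximalideal.quotient_is_field[OF P class_cring.cring_axioms])
  let ?UP = "poly_ring (residue_field P)"
  let ?r = "reduce_poly P"
  note carr = reduce_poly_in_carrier[OF I]
  show ?thesis using \<Gamma>(1)[unfolded is_approx_sqrt_def]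
  proof (elim exE conjE, goal_cases)
    case (1 m \<gamma> d)
    note inj = 1(2) and \<phi> = 1(3) and G = 1(4)
    have \<gamma>: "\<gamma> i \<in> carrier ?UP" "ring_irreducible\<^bsub>?UP\<^esub> (\<gamma> i)" "hd (\<gamma> i) = \<one>\<^bsub>residue_field P\<^esub>"
      if "i \<in> {1..m}" for i using bspec[OF 1(1) that] by simp_all
    have "?r x \<otimes>\<^bsub>?UP\<^esub> ?r x = ?r (char_poly M) \<otimes>\<^bsub>?UP\<^esub> ?r b"
      using x by (simp add: reduce_poly_mult[OF I, symmetric] reduce_poly_eq_iff[OF I])
    then have "(\<Otimes>\<^bsub>?UP\<^esub>i\<in>{1..m}. \<gamma> i [^]\<^bsub>?UP\<^esub> d i) pdivides\<^bsub>residue_field P\<^esub> (?r x \<otimes>\<^bsub>?UP\<^esub> ?r x)"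
      unfolding \<phi> using carr by (rule F.pdividesI[rotated])
    from F.finprod_pow_pdivides_halves_mult[OF _ \<gamma> inj carr this]
    have "?r (char_poly M) pdivides\<^bsub>residue_field P\<^esub> (?r g \<otimes>\<^bsub>?UP\<^esub> ?r x)"
      unfolding \<phi> \<Gamma>(2) G by simp
    then obtain q where q: "q \<in> carrier ?UP" "?r g \<otimes>\<^bsub>?UP\<^esub> ?r x = ?r (char_poly M) \<otimes>\<^bsub>?UP\<^esub> q"
      by (rule F.pdividesE)
    obtain c where "?r c = q" using reduce_poly_surj[OF I q(1)] by blast
    then have "?r (g * x) = ?r (char_poly M * c)" using q(2) by (simp add: reduce_poly_mult[OF I])
    then show ?case using that by (simp add: reduce_poly_eq_iff[OF I])
  qed
qed

section \<open>Matrices\<close>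

lemma mult_mat_vec_smult:
  fixes A :: "'a::comm_ring_1 mat"
  assumes "A \<in> carrier_mat nr nc" "v \<in> carrier_vec nc"
  shows "A *\<^sub>v (k \<cdot>\<^sub>v v) = k \<cdot>\<^sub>v (A *\<^sub>v v)"
  using assms by (intro eq_vecI) auto

lemma mult_mat_zero_vec:
  fixes A :: "'a::comm_ring_1 mat"
  assumes "A \<in> carrier_mat nr nc"
  shows "A *\<^sub>v 0\<^sub>v nc = 0\<^sub>v nr"
  using assms by (intro eq_vecI) auto

lemma pow_mat_mult_vec:
  fixes A :: "'a::comm_ring_1 mat"
  assumes "A \<in> carrier_mat n n" "v \<in> carrier_vec n"
  shows "A ^\<^sub>m Suc j *\<^sub>v v = A ^\<^sub>m j *\<^sub>v (A *\<^sub>v v)"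
  using assms by (simp add: assoc_mult_mat_vec[of _ n n _ n])

section \<open>Adjugates and their minors\<close>

lemma det_2x2:
  fixes A :: "'a::comm_ring_1 mat"
  assumes A: "A \<in> carrier_mat 2 2"
  shows "det A = A $$ (0,0) * A $$ (1,1) - A $$ (0,1) * A $$ (1,0)"
proof -
  have d: "det (mat_delete A i j) = mat_delete A i j $$ (0,0)" for i j
    using mat_delete_carrier[OF A, of i j] by (intro det_single) simp
  have "det A = (\<Sum>i<2. A $$ (i,0) * cofactor A i 0)"
    by (rule laplace_expansion_column[OF A]) simp
  also have "\<dots> = A $$ (0,0) * A $$ (1,1) - A $$ (1,0) * A $$ (0,1)"
    using A by (simp add: cofactor_def d numeral_2_eq_2) (simp add: mat_delete_def)
  finally show ?thesis by (simp add: mult.commute)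
qed

text \<open>The transpose of adj A satisfies the same equation A B = det A I as adj A itself.
  Multiplying on the left by adj A gives det A times the claim, and det A cancels because the ring
  is a domain.\<close>

lemma adj_mat_symmetric:
  fixes A :: "'a::idom mat"
  assumes A: "A \<in> carrier_mat n n" and sym: "transpose_mat A = A" and det: "det A \<noteq> 0"
  shows "transpose_mat (adj_mat A) = adj_mat A"
proof -
  note adj = adj_mat[OF A]
  have T: "transpose_mat (adj_mat A) \<in> carrier_mat n n" using adj(1) by simp
  have "A * transpose_mat (adj_mat A) = transpose_mat (adj_mat A * A)"
    using transpose_mult[OF adj(1) A] sym by simp
  also have "\<dots> = det A \<cdot>\<^sub>m 1\<^sub>m n" unfolding adj(3) by (intro eq_matI) auto
  finally have "adj_mat A * (A * transpose_mat (adj_mat A)) = adj_mat A * (det A \<cdot>\<^sub>m 1\<^sub>m n)" by simp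
  also have "\<dots> = det A \<cdot>\<^sub>m adj_mat A"
    using mult_smult_distrib[OF adj(1) one_carrier_mat] right_mult_one_mat[OF adj(1)] by simp
  also have "adj_mat A * (A * transpose_mat (adj_mat A)) = (adj_mat A * A) * transpose_mat (adj_mat A)"
    using adj(1) A T by simp
  also have "\<dots> = det A \<cdot>\<^sub>m transpose_mat (adj_mat A)" 
    unfolding adj(3) using mult_smult_assoc_mat[OF one_carrier_mat T] left_mult_one_mat[OF T] by simp
  finally have eq: "det A \<cdot>\<^sub>m transpose_mat (adj_mat A) = det A \<cdot>\<^sub>m adj_mat A" .
  show ?thesis
  proof (rule eq_matI)
    fix i j assume ij: "i < dim_row (adj_mat A)" "j < dim_col (adj_mat A)"
    then have "(det A \<cdot>\<^sub>m transpose_mat (adj_mat A)) $$ (i,j) = (det A \<cdot>\<^sub>m adj_mat A) $$ (i,j)"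
      by (simp only: eq)
    then show "transpose_mat (adj_mat A) $$ (i,j) = adj_mat A $$ (i,j)"
      using ij det adj(1) T by auto
  qed (use adj(1) in auto)
qed

text \<open>The quotient is the determinant of the bordered matrix with blocks \<open>A, W, W\<^sup>T, 0\<close>, where
\<open>W\<close> has the columns \<open>u\<close> and \<open>v\<close> (Schur complement).\<close>

lemma det_dvd_adj_mat_minor:
  fixes A :: "'a::idom mat"
  assumes A: "A \<in> carrier_mat n n" and det: "det A \<noteq> 0"
    and u: "u \<in> carrier_vec n" and v: "v \<in> carrier_vec n"
  shows "det A dvd (u \<bullet> (adj_mat A *\<^sub>v u)) * (v \<bullet> (adj_mat A *\<^sub>v v)) -
    (u \<bullet> (adj_mat A *\<^sub>v v)) * (v \<bullet> (adj_mat A *\<^sub>v u))"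
proof -
  note adj = adj_mat[OF A]
  define W where "W = mat n 2 (\<lambda>(i, j). if j = 0 then u $ i else v $ i)"
  have W: "W \<in> carrier_mat n 2" by (simp add: W_def)
  have colW: "col W 0 = u" "col W 1 = v" using u v by (auto simp: W_def)
  define Z where "Z = transpose_mat W * (adj_mat A * W)"
  have Z: "Z \<in> carrier_mat 2 2" using W adj(1) by (simp add: Z_def)
  define B where "B = four_block_mat A W (transpose_mat W) (0\<^sub>m 2 2)"
  \<comment> \<open>\<open>N\<close> clears the upper right block of \<open>B\<close> without
    denominators: A (adj A) W = det A W is matched by scaling W by det A. Taking determinants gives
    det B (det A)^2 = det A det(-Z).\<close>
  define N where "N = four_block_mat (1\<^sub>m n) (- (adj_mat A * W)) (0\<^sub>m 2 n) (det A \<cdot>\<^sub>m 1\<^sub>m 2)"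
  have BN: "B \<in> carrier_mat (n + 2) (n + 2)" "N \<in> carrier_mat (n + 2) (n + 2)"
    using A W adj(1) unfolding B_def N_def by auto
  have AadjW: "A * (adj_mat A * W) = det A \<cdot>\<^sub>m W"
  proof -
    have "A * (adj_mat A * W) = (A * adj_mat A) * W" using A adj(1) W by simp
    then show ?thesis
      unfolding adj(2) using mult_smult_assoc_mat[OF one_carrier_mat W] left_mult_one_mat[OF W] by simp
  qed
  have "B * N = four_block_mat A (0\<^sub>m n 2) (transpose_mat W) (- Z)"
  proof -
    have "B * N = four_block_mat (A * 1\<^sub>m n + W * 0\<^sub>m 2 n)
        (A * (- (adj_mat A * W)) + W * (det A \<cdot>\<^sub>m 1\<^sub>m 2))
        (transpose_mat W * 1\<^sub>m n + 0\<^sub>m 2 2 * 0\<^sub>m 2 n)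
        (transpose_mat W * (- (adj_mat A * W)) + 0\<^sub>m 2 2 * (det A \<cdot>\<^sub>m 1\<^sub>m 2))"
      unfolding B_def N_def by (rule mult_four_block_mat) (use A W adj(1) in auto)
    also have "A * 1\<^sub>m n + W * 0\<^sub>m 2 n = A" using A W by simp
    also have "A * (- (adj_mat A * W)) + W * (det A \<cdot>\<^sub>m 1\<^sub>m 2) = 0\<^sub>m n 2"
    proof -
      have "A * (- (adj_mat A * W)) = - (det A \<cdot>\<^sub>m W)"
        using uminus_mult_right_mat[of A "adj_mat A * W"] A W adj(1) AadjW by simp
      moreover have "W * (det A \<cdot>\<^sub>m 1\<^sub>m 2) = det A \<cdot>\<^sub>m W"
        using mult_smult_distrib[OF W one_carrier_mat] right_mult_one_mat[OF W] by simp
      ultimately show ?thesis using W by (intro eq_matI) auto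
    qed
    also have "transpose_mat W * 1\<^sub>m n + 0\<^sub>m 2 2 * 0\<^sub>m 2 n = transpose_mat W" using W by simp
    also have "transpose_mat W * (- (adj_mat A * W)) + 0\<^sub>m 2 2 * (det A \<cdot>\<^sub>m 1\<^sub>m 2) = - Z"
      using W adj(1) unfolding Z_def by (intro eq_matI) auto
    finally show ?thesis .
  qed
  then have "det B * det N = det A * det (- Z)"
    using det_mult[OF BN] det_four_block_mat_upper_right_zero[OF A _ _ , of "0\<^sub>m n 2" 2 "transpose_mat W" "- Z"] W Z
    by simp
  moreover have "det N = det A ^ 2"
    unfolding N_def by (subst det_four_block_mat_lower_left_zero[of _ n _ 2]) (use W adj(1) in auto)
  ultimately have "det A * (det B * det A) = det A * det (- Z)" by (simp add: power2_eq_square mult_ac)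
  then have *: "det B * det A = det (- Z)" using det by simp
  have entry: "Z $$ (i, j) = col W i \<bullet> (adj_mat A *\<^sub>v col W j)" if "i < 2" "j < 2" for i j
  proof -
    have "col (adj_mat A * W) j = adj_mat A *\<^sub>v col W j" using adj(1) W that by (intro eq_vecI) auto
    then show ?thesis unfolding Z_def using W adj(1) that by simp
  qed
  \<comment> \<open>The sign disappears because the block has size two.\<close>
  have "det (- Z) = Z $$ (0,0) * Z $$ (1,1) - Z $$ (0,1) * Z $$ (1,0)"
    using det_2x2[of "- Z"] Z by simp
  also have "\<dots> = (u \<bullet> (adj_mat A *\<^sub>v u)) * (v \<bullet> (adj_mat A *\<^sub>v v)) -
      (u \<bullet> (adj_mat A *\<^sub>v v)) * (v \<bullet> (adj_mat A *\<^sub>v u))"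
    by (simp add: entry colW[simplified])
  finally show ?thesis using * by (metis dvd_triv_right)
qed

section \<open>The matrix x - M and coefficients of polynomial vectors\<close>

lemma char_poly_matrix_symmetric:
  assumes "M \<in> carrier_mat n n" "transpose_mat M = M"
  shows "transpose_mat (char_poly_matrix M) = char_poly_matrix M"
proof (rule eq_matI)
  fix i j assume "i < dim_row (char_poly_matrix M)" "j < dim_col (char_poly_matrix M)"
  then have ij: "i < n" "j < n" using assms(1) by (auto simp: char_poly_matrix_def)
  have "M $$ (j,i) = M $$ (i,j)" using assms ij by (metis carrier_matD index_transpose_mat(1))
  then show "transpose_mat (char_poly_matrix M) $$ (i,j) = char_poly_matrix M $$ (i,j)"
    using ij assms(1) by (auto simp: char_poly_matrix_def)
qed (use assms in \<open>auto simp: char_poly_matrix_def\<close>)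

lemma char_poly_matrix_mult_index:
  fixes M :: "'a::comm_ring_1 mat"
  assumes M: "M \<in> carrier_mat n n" and y: "y \<in> carrier_vec n" and i: "i < n"
  shows "(char_poly_matrix M *\<^sub>v y) $ i = pCons 0 (y $ i) - (\<Sum>j<n. [:M $$ (i,j):] * y $ j)"
proof -
  have "(char_poly_matrix M *\<^sub>v y) $ i =
      (\<Sum>j<n. (if i = j then [:0,1:] * y $ j else 0) - [:M $$ (i,j):] * y $ j)"
    using M y i
    by (auto simp: char_poly_matrix_def scalar_prod_def atLeast0LessThan algebra_simps intro!: sum.cong)
  also have "\<dots> = pCons 0 (y $ i) - (\<Sum>j<n. [:M $$ (i,j):] * y $ j)"
    using i by (simp add: sum_subtractf)
  finally show ?thesis .
qed

text \<open>This reads a vector over R[x] as a polynomial in x with coefficients in R^n.\<close>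

definition coeff_vec :: "nat \<Rightarrow> 'a::zero poly vec \<Rightarrow> nat \<Rightarrow> 'a vec" where
  "coeff_vec n y k = vec n (\<lambda>i. Polynomial.coeff (y $ i) k)"

lemma coeff_vec_carrier [simp]: "coeff_vec n y k \<in> carrier_vec n"
  by (simp add: coeff_vec_def)

text \<open>On polynomials with coefficients in R^n, the matrix x - M acts as the degree shift minus
  M. The shift contributes nothing to the constant term, which is why index 0 is separate.\<close>

lemma coeff_vec_char_poly_matrix:
  fixes M :: "'a::comm_ring_1 mat"
  assumes M: "M \<in> carrier_mat n n" and y: "y \<in> carrier_vec n"
  shows "coeff_vec n (char_poly_matrix M *\<^sub>v y) 0 = - (M *\<^sub>v coeff_vec n y 0)"
    and "coeff_vec n (char_poly_matrix M *\<^sub>v y) (Suc k) = coeff_vec n y k - M *\<^sub>v coeff_vec n y (Suc k)"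
  using M
  by (auto simp: vec_eq_iff coeff_vec_def char_poly_matrix_mult_index[OF M y] coeff_sum scalar_prod_def
      atLeast0LessThan simp del: index_mult_mat_vec intro!: sum.cong)
    (auto simp: scalar_prod_def atLeast0LessThan intro!: sum.cong)

lemma coeff_vec_eventually_zero:
  obtains N where "\<And>k. k \<ge> N \<Longrightarrow> coeff_vec n y k = 0\<^sub>v n"
proof -
  have "coeff_vec n y k = 0\<^sub>v n" if "k \<ge> Suc (\<Sum>i<n. Polynomial.degree (y $ i))" for k
  proof (rule eq_vecI)
    fix i assume "i < dim_vec (0\<^sub>v n)"
    then have i: "i < n" by simp
    then have "Polynomial.degree (y $ i) \<le> (\<Sum>i<n. Polynomial.degree (y $ i))"
      by (intro member_le_sum) auto
    then show "coeff_vec n y k $ i = 0\<^sub>v n $ i" using that i by (simp add: coeff_vec_def coeff_eq_0)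
  qed (simp add: coeff_vec_def)
  then show ?thesis using that by blast
qed

lemma scalar_prod_in_ideal:
  fixes v :: "'a::idom vec"
  assumes "ideal I class_ring" "w \<in> carrier_vec n" "\<And>i. i < n \<Longrightarrow> w $ i \<in> I"
  shows "v \<bullet> w \<in> I"
  unfolding scalar_prod_def using assms
  by (intro class_ideal_sum[OF assms(1)] class_ideal_mult[OF assms(1)]) auto

lemma mult_mat_vec_in_ideal:
  fixes A :: "'a::idom mat"
  assumes "ideal I class_ring" "A \<in> carrier_mat m n" "w \<in> carrier_vec n" "\<And>i. i < n \<Longrightarrow> w $ i \<in> I" "j < m"
  shows "(A *\<^sub>v w) $ j \<in> I"
  using scalar_prod_in_ideal[OF assms(1,3,4)] assms(2,5) by simp

text \<open>The coefficients of \<open>adj(x - M) u\<close> lie in the Krylov space of \<open>u\<close>: the top one vanishes, and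
comparing coefficients in \<open>(x - M) h = \<phi> u\<close> gives each from the next one.\<close>

lemma isotropic_adj_mat_char_poly:
  fixes M :: "'a::idom mat"
  assumes I: "ideal I class_ring" and M: "M \<in> carrier_mat n n" and u: "u \<in> carrier_vec n"
    and iso: "\<And>j. u \<bullet> (M ^\<^sub>m j *\<^sub>v u) \<in> I"
  defines "U \<equiv> map_vec (\<lambda>c. [:c:]) u"
  shows "U \<bullet> (adj_mat (char_poly_matrix M) *\<^sub>v U) \<in> coeffs_in I"
proof -
  let ?A = "char_poly_matrix M"
  have A: "?A \<in> carrier_mat n n" using M by simp
  note adj = adj_mat[OF A]
  have U: "U \<in> carrier_vec n" using u by (simp add: U_def)
  define h where "h = adj_mat ?A *\<^sub>v U"
  have h: "h \<in> carrier_vec n" using adj(1) U by (simp add: h_def)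
  have Ah: "?A *\<^sub>v h = char_poly M \<cdot>\<^sub>v U"
  proof -
    have "?A *\<^sub>v h = (?A * adj_mat ?A) *\<^sub>v U" unfolding h_def using A adj(1) U by simp
    also have "\<dots> = char_poly M \<cdot>\<^sub>v U" unfolding adj(2) using U by (auto simp: char_poly_def)
    finally show ?thesis .
  qed
  \<comment> \<open>Asking for orthogonality of u to the whole orbit of v, and not only to v, makes
    this submodule stable under M; the hypothesis \<open>iso\<close> says that it contains
    u.\<close>
  define S where "S = {v \<in> carrier_vec n. \<forall>j. u \<bullet> (M ^\<^sub>m j *\<^sub>v v) \<in> I}"
  have pow: "M ^\<^sub>m j \<in> carrier_mat n n" for j using M by simp
  have mv: "M ^\<^sub>m j *\<^sub>v v \<in> carrier_vec n" if "v \<in> carrier_vec n" for j v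
    using pow that by (rule mult_mat_vec_carrier)
  have S_add: "v + w \<in> S" if "v \<in> S" "w \<in> S" for v w
  proof -
    have v: "v \<in> carrier_vec n" and w: "w \<in> carrier_vec n" using that by (auto simp: S_def)
    have "u \<bullet> (M ^\<^sub>m j *\<^sub>v (v + w)) = u \<bullet> (M ^\<^sub>m j *\<^sub>v v) + u \<bullet> (M ^\<^sub>m j *\<^sub>v w)" for j
      unfolding mult_add_distrib_mat_vec[OF pow v w] by (rule scalar_prod_add_distrib[OF u mv[OF v] mv[OF w]])
    then show ?thesis using that class_ideal_add[OF I] by (simp add: S_def)
  qed
  have S_smult: "c \<cdot>\<^sub>v v \<in> S" if "v \<in> S" for c v
  proof -
    have v: "v \<in> carrier_vec n" using that by (auto simp: S_def)
    have "u \<bullet> (M ^\<^sub>m j *\<^sub>v (c \<cdot>\<^sub>v v)) = c * (u \<bullet> (M ^\<^sub>m j *\<^sub>v v))" for j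
      unfolding mult_mat_vec_smult[OF pow v] by (rule scalar_prod_smult_distrib[OF u mv[OF v]])
    then show ?thesis using that class_ideal_mult[OF I] by (simp add: S_def)
  qed
  have S_M: "M *\<^sub>v v \<in> S" if "v \<in> S" for v
    using that M by (auto simp: S_def pow_mat_mult_vec[symmetric] simp del: pow_mat.simps)
  have u_S: "u \<in> S" using u iso by (simp add: S_def)
  have rec: "coeff_vec n h k = M *\<^sub>v coeff_vec n h (Suc k) + Polynomial.coeff (char_poly M) (Suc k) \<cdot>\<^sub>v u" for k
  proof (rule eq_vecI)
    fix i assume "i < dim_vec (M *\<^sub>v coeff_vec n h (Suc k) + Polynomial.coeff (char_poly M) (Suc k) \<cdot>\<^sub>v u)"
    then have i: "i < n" using u by simp
    have "coeff_vec n (char_poly M \<cdot>\<^sub>v U) (Suc k) = coeff_vec n h k - M *\<^sub>v coeff_vec n h (Suc k)"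
      using coeff_vec_char_poly_matrix(2)[OF M h] Ah by simp
    then have "coeff_vec n (char_poly M \<cdot>\<^sub>v U) (Suc k) $ i = (coeff_vec n h k - M *\<^sub>v coeff_vec n h (Suc k)) $ i"
      by (rule arg_cong)
    then have "Polynomial.coeff (char_poly M) (Suc k) * u $ i =
        coeff_vec n h k $ i - (M *\<^sub>v coeff_vec n h (Suc k)) $ i"
      using i u M by (simp add: coeff_vec_def U_def mult.commute)
    then show "coeff_vec n h k $ i =
        (M *\<^sub>v coeff_vec n h (Suc k) + Polynomial.coeff (char_poly M) (Suc k) \<cdot>\<^sub>v u) $ i"
      using i u M by (simp del: index_mult_mat_vec)
  qed (use u in \<open>simp add: coeff_vec_def\<close>)
  obtain N where N: "\<And>k. k \<ge> N \<Longrightarrow> coeff_vec n h k = 0\<^sub>v n"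
    using coeff_vec_eventually_zero[of n h] by blast
  have zero_S: "0\<^sub>v n \<in> S"
    using u class_ideal_zero[OF I] by (simp add: S_def mult_mat_zero_vec[OF pow])
  have "coeff_vec n h k \<in> S" for k
  proof (induction "N - k" arbitrary: k)
    case 0
    then show ?case using N zero_S by simp
  next
    case (Suc d)
    then have "coeff_vec n h (Suc k) \<in> S" by simp
    then show ?case unfolding rec[of k] by (intro S_add S_M S_smult u_S)
  qed
  then have "u \<bullet> (M ^\<^sub>m 0 *\<^sub>v coeff_vec n h k) \<in> I" for k unfolding S_def by blast
  then have orth: "u \<bullet> coeff_vec n h k \<in> I" for k using M by simp
  have "Polynomial.coeff (U \<bullet> h) k = u \<bullet> coeff_vec n h k" for k
    using h u unfolding scalar_prod_def U_def by (auto simp: coeff_sum coeff_vec_def intro!: sum.cong)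
  then show ?thesis using orth unfolding coeffs_in_def h_def[symmetric] by simp
qed

section \<open>Evaluation at M and annihilation of isotropic vectors\<close>

lemma mat_eval_carrier:
  fixes M :: "'a::idom mat"
  assumes "M \<in> carrier_mat n n"
  shows "mat_eval n g M \<in> carrier_mat n n"
proof -
  interpret R: ring "ring_mat TYPE('a) n ()" by (rule ring_mat)
  show ?thesis
    using assms R.finsum_closed[of "\<lambda>i. Polynomial.coeff g i \<cdot>\<^sub>m (M ^\<^sub>m i)" "{..Polynomial.degree g}"]
    by (simp add: mat_eval_def ring_mat_simps Pi_iff)
qed

lemma mat_eval_mult_vec_index:
  fixes M :: "'a::idom mat"
  assumes M: "M \<in> carrier_mat n n" and u: "u \<in> carrier_vec n" and i: "i < n"
  shows "(mat_eval n g M *\<^sub>v u) $ i =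
    (\<Sum>k\<le>Polynomial.degree g. Polynomial.coeff g k * (M ^\<^sub>m k *\<^sub>v u) $ i)"
proof -
  let ?R = "ring_mat TYPE('a) n ()"
  interpret R: ring ?R by (rule ring_mat)
  let ?f = "\<lambda>k. Polynomial.coeff g k \<cdot>\<^sub>m (M ^\<^sub>m k)"
  have f: "?f k \<in> carrier_mat n n" for k using M by simp
  have *: "finsum ?R ?f S \<in> carrier_mat n n \<and>
      (finsum ?R ?f S *\<^sub>v u) $ i = (\<Sum>k\<in>S. Polynomial.coeff g k * (M ^\<^sub>m k *\<^sub>v u) $ i)"
    if "finite S" for S
    using that
  proof (induction S rule: finite_induct)
    case empty
    then show ?case using u i by (simp add: ring_mat_simps)
  next
    case (insert k S)
    have "finsum ?R ?f (insert k S) = ?f k + finsum ?R ?f S"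
      using insert f by (subst R.finsum_insert) (auto simp: ring_mat_simps)
    then show ?case using insert f[of k] u i M
      by (simp add: add_mult_distrib_mat_vec[of _ n n] del: index_mult_mat_vec)
        (auto simp: row_smult)
  qed
  show "(mat_eval n g M *\<^sub>v u) $ i =
      (\<Sum>k\<le>Polynomial.degree g. Polynomial.coeff g k * (M ^\<^sub>m k *\<^sub>v u) $ i)"
    unfolding mat_eval_def using *[of "{..Polynomial.degree g}"] by simp
qed

text \<open>Right evaluation of \<open>(x - M) y = g u\<close> at \<open>x = M\<close>; the left side telescopes to \<open>0\<close>.\<close>

lemma mat_eval_in_ideal:
  fixes M :: "'a::idom mat"
  assumes I: "ideal I class_ring" and M: "M \<in> carrier_mat n n" and u: "u \<in> carrier_vec n"
    and y: "y \<in> carrier_vec n"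
    and eq: "\<And>i. i < n \<Longrightarrow> (char_poly_matrix M *\<^sub>v y) $ i - g * [:u $ i:] \<in> coeffs_in I" and i: "i < n"
  shows "(mat_eval n g M *\<^sub>v u) $ i \<in> I"
proof -
  let ?E = "\<lambda>k. coeff_vec n (char_poly_matrix M *\<^sub>v y) k"
  have pow: "M ^\<^sub>m k \<in> carrier_mat n n" for k using M by simp
  \<comment> \<open>For k > 0 the k-th term is M^k y_(k-1) - M^(k+1) y_k, where y_k is the k-th
    coefficient vector of y, so only the last boundary term survives.\<close>
  have tele: "(\<Sum>k\<le>N. (M ^\<^sub>m k *\<^sub>v ?E k) $ i) = - (M ^\<^sub>m Suc N *\<^sub>v coeff_vec n y N) $ i" for N
  proof (induction N)
    case 0
    show ?case using coeff_vec_char_poly_matrix(1)[OF M y] M i by simp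
  next
    case (Suc N)
    have "M ^\<^sub>m Suc N *\<^sub>v ?E (Suc N) =
        M ^\<^sub>m Suc N *\<^sub>v coeff_vec n y N - M ^\<^sub>m Suc N *\<^sub>v (M *\<^sub>v coeff_vec n y (Suc N))"
      unfolding coeff_vec_char_poly_matrix(2)[OF M y]
      by (rule mult_minus_distrib_mat_vec[OF pow]) (use M in auto)
    also have "M ^\<^sub>m Suc N *\<^sub>v (M *\<^sub>v coeff_vec n y (Suc N)) = M ^\<^sub>m Suc (Suc N) *\<^sub>v coeff_vec n y (Suc N)"
      by (rule pow_mat_mult_vec[OF M, symmetric]) simp
    finally have "(M ^\<^sub>m Suc N *\<^sub>v ?E (Suc N)) $ i =
        (M ^\<^sub>m Suc N *\<^sub>v coeff_vec n y N) $ i - (M ^\<^sub>m Suc (Suc N) *\<^sub>v coeff_vec n y (Suc N)) $ i"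
      using i carrier_matD(1)[OF pow[of "Suc (Suc N)"]] by (simp del: index_mult_mat_vec pow_mat.simps)
    then show ?case using Suc by (simp del: index_mult_mat_vec pow_mat.simps)
  qed
  obtain N0 where N0: "\<And>k. k \<ge> N0 \<Longrightarrow> coeff_vec n y k = 0\<^sub>v n"
    using coeff_vec_eventually_zero[of n y] by blast
  \<comment> \<open>Large enough for the boundary term of the telescoping sum to vanish and for the
    sum to contain all coefficients of g.\<close>
  define N where "N = max N0 (Polynomial.degree g)"
  have "coeff_vec n y N = 0\<^sub>v n" using N0 by (simp add: N_def)
  then have sum0: "(\<Sum>k\<le>N. (M ^\<^sub>m k *\<^sub>v ?E k) $ i) = 0"
    using tele[of N] i by (simp add: mult_mat_zero_vec[OF pow] del: pow_mat.simps index_mult_mat_vec)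
  \<comment> \<open>The error of the congruence \<open>eq\<close>, read coefficientwise; its entries
    lie in I, and powers of M keep them there.\<close>
  define p where "p k = ?E k - Polynomial.coeff g k \<cdot>\<^sub>v u" for k
  have p: "p k \<in> carrier_vec n" for k using u by (simp add: p_def)
  have pI: "p k $ j \<in> I" if "j < n" for j k
    using eq[OF that] that u by (simp add: p_def coeff_vec_def coeffs_in_def mult.commute)
  have E: "(M ^\<^sub>m k *\<^sub>v ?E k) $ i = Polynomial.coeff g k * (M ^\<^sub>m k *\<^sub>v u) $ i + (M ^\<^sub>m k *\<^sub>v p k) $ i" for k
  proof -
    have "?E k = Polynomial.coeff g k \<cdot>\<^sub>v u + p k" using u by (auto simp: p_def vec_eq_iff coeff_vec_def)
    then have "M ^\<^sub>m k *\<^sub>v ?E k = Polynomial.coeff g k \<cdot>\<^sub>v (M ^\<^sub>m k *\<^sub>v u) + M ^\<^sub>m k *\<^sub>v p k"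
      using u p mult_add_distrib_mat_vec[OF pow, of "Polynomial.coeff g k \<cdot>\<^sub>v u" "p k"] mult_mat_vec_smult[OF pow u]
      by simp
    then show ?thesis using i carrier_matD(1)[OF pow[of k]] by (simp del: index_mult_mat_vec)
  qed
  have "(mat_eval n g M *\<^sub>v u) $ i = (\<Sum>k\<le>N. Polynomial.coeff g k * (M ^\<^sub>m k *\<^sub>v u) $ i)"
    unfolding mat_eval_mult_vec_index[OF M u i]
    by (rule sum.mono_neutral_left) (auto simp: N_def coeff_eq_0)
  also have "\<dots> = - (\<Sum>k\<le>N. (M ^\<^sub>m k *\<^sub>v p k) $ i)"
    using sum0 by (simp only: E sum.distrib) (simp add: eq_neg_iff_add_eq_0)
  also have "\<dots> \<in> I"
    by (intro class_ideal_uminus[OF I] class_ideal_sum[OF I] mult_mat_vec_in_ideal[OF I pow p pI i])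
  finally show ?thesis .
qed

text \<open>Over R[x] the minor divisibility is an exact statement about a nonzero determinant, and
  \<phi> is monic. Reduction modulo P[x] therefore comes only afterwards, and \<phi> can still be
  cancelled.\<close>

lemma approx_sqrt_annihilates_isotropic:
  fixes M :: "'a::idom mat"
  assumes P: "maximalideal P class_ring" and M: "M \<in> carrier_mat n n" and sym: "transpose_mat M = M"
    and \<Gamma>: "is_approx_sqrt P M \<Gamma>" "reduce_poly P g = \<Gamma>"
    and u: "u \<in> carrier_vec n" and iso: "\<And>j. u \<bullet> (M ^\<^sub>m j *\<^sub>v u) \<in> P" and i: "i < n"
  shows "(mat_eval n g M *\<^sub>v u) $ i \<in> P"
proof -
  have I: "ideal P class_ring" using P by (simp add: maximalideal_def)
  note PX = ideal_coeffs_in[OF I]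
  let ?A = "char_poly_matrix M"
  let ?\<phi> = "char_poly M"
  have A: "?A \<in> carrier_mat n n" using M by simp
  note adj = adj_mat[OF A]
  have monic: "Polynomial.lead_coeff ?\<phi> = 1" using degree_monic_char_poly[OF M] by simp
  have det: "det ?A \<noteq> 0" using monic by (auto simp: char_poly_def)
  define U where "U = map_vec (\<lambda>c. [:c:]) u"
  have U: "U \<in> carrier_vec n" using u by (simp add: U_def)
  define h where "h = adj_mat ?A *\<^sub>v U"
  have h: "h \<in> carrier_vec n" using adj(1) U by (simp add: h_def)
  have uh: "U \<bullet> h \<in> coeffs_in P"
    unfolding h_def U_def by (rule isotropic_adj_mat_char_poly[OF I M u iso])
  have "\<exists>c. g * h $ i - ?\<phi> * c \<in> coeffs_in P" if i: "i < n" for i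
  proof -
    \<comment> \<open>Pairing u with a unit vector makes both off-diagonal products of the minor
      equal to h_i: one by definition of h, the other by symmetry of the adjugate. The diagonal
      product contains u^T h and vanishes modulo P.\<close>
    let ?e = "unit_vec n i :: 'a poly vec"
    have e: "?e \<in> carrier_vec n" by simp
    have eh: "?e \<bullet> h = h $ i" using h i by simp
    have "U \<bullet> (adj_mat ?A *\<^sub>v ?e) = (transpose_mat (adj_mat ?A) *\<^sub>v U) \<bullet> ?e"
      using transpose_vec_mult_scalar[OF adj(1) e U] by simp
    also have "\<dots> = h \<bullet> ?e"
      unfolding adj_mat_symmetric[OF A char_poly_matrix_symmetric[OF M sym] det] h_def ..
    also have "\<dots> = h $ i" using h i by simp
    finally have "?\<phi> dvd (U \<bullet> h) * (?e \<bullet> (adj_mat ?A *\<^sub>v ?e)) - h $ i * h $ i"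
      using det_dvd_adj_mat_minor[OF A det U e] eh unfolding h_def[symmetric] by (simp add: char_poly_def)
    then obtain b where "(U \<bullet> h) * (?e \<bullet> (adj_mat ?A *\<^sub>v ?e)) - h $ i * h $ i = ?\<phi> * b" by (rule dvdE)
    then have "h $ i * h $ i - ?\<phi> * (- b) = (U \<bullet> h) * (?e \<bullet> (adj_mat ?A *\<^sub>v ?e))" by (simp add: algebra_simps)
    also have "\<dots> \<in> coeffs_in P" by (rule class_ideal_mult_right[OF PX uh])
    finally show ?thesis using approx_sqrt_mult[OF P \<Gamma>] by blast
  qed
  then obtain c where c: "\<And>i. i < n \<Longrightarrow> g * h $ i - ?\<phi> * c i \<in> coeffs_in P" by metis
  \<comment> \<open>The entrywise quotient of g h by \<phi> modulo P.\<close>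
  define y where "y = vec n c"
  have y: "y \<in> carrier_vec n" by (simp add: y_def)
  have Ah: "?A *\<^sub>v h = ?\<phi> \<cdot>\<^sub>v U"
  proof -
    have "?A *\<^sub>v h = (?A * adj_mat ?A) *\<^sub>v U" unfolding h_def using A adj(1) U by simp
    also have "\<dots> = ?\<phi> \<cdot>\<^sub>v U" unfolding adj(2) using U by (auto simp: char_poly_def)
    finally show ?thesis .
  qed
  have "(?A *\<^sub>v y) $ i - g * [:u $ i:] \<in> coeffs_in P" if i: "i < n" for i
  proof -
    \<comment> \<open>Since w vanishes modulo P, so does (x - M) w = \<phi> ((x - M) y - g u), and
      the monic \<phi> cancels.\<close>
    define w where "w = ?\<phi> \<cdot>\<^sub>v y - g \<cdot>\<^sub>v h"
    have w: "w \<in> carrier_vec n" using h y by (simp add: w_def)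
    have "w $ j \<in> coeffs_in P" if "j < n" for j
      using class_ideal_uminus[OF PX c[OF that]] that h by (simp add: w_def y_def)
    then have "(?A *\<^sub>v w) $ i \<in> coeffs_in P" by (rule mult_mat_vec_in_ideal[OF PX A w _ i])
    moreover have "?A *\<^sub>v w = ?\<phi> \<cdot>\<^sub>v (?A *\<^sub>v y) - g \<cdot>\<^sub>v (?\<phi> \<cdot>\<^sub>v U)"
      unfolding w_def using mult_minus_distrib_mat_vec[OF A, of "?\<phi> \<cdot>\<^sub>v y" "g \<cdot>\<^sub>v h"] y h
      by (simp add: mult_mat_vec_smult[OF A] Ah)
    ultimately have "?\<phi> * ((?A *\<^sub>v y) $ i - g * [:u $ i:]) \<in> coeffs_in P"
      using i A U u by (simp add: U_def algebra_simps del: index_mult_mat_vec)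
    then show ?thesis by (rule monic_cancel_coeffs_in[OF I monic])
  qed
  then show ?thesis by (rule mat_eval_in_ideal[OF I M u y _ i])
qed

section \<open>Submodules and Krylov spaces\<close>

definition submod :: "nat \<Rightarrow> 'a::idom vec set \<Rightarrow> bool" where
  "submod n N \<longleftrightarrow> N \<subseteq> carrier_vec n \<and> 0\<^sub>v n \<in> N \<and> (\<forall>v\<in>N. \<forall>w\<in>N. v + w \<in> N) \<and> (\<forall>c. \<forall>v\<in>N. c \<cdot>\<^sub>v v \<in> N)"

section \<open>Finite sums of vectors\<close>

lemma submod_finsum:
  assumes N: "submod n N" and "finite S" "\<And>i. i \<in> S \<Longrightarrow> f i \<in> N"
  shows "finsum_vec TYPE('a::idom) n f S \<in> N"
  using assms(2,3)
proof (induction S rule: finite_induct)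
  case empty
  then show ?case using N by (simp add: finsum_vec_empty submod_def)
next
  case (insert i S)
  have "f \<in> S \<rightarrow> carrier_vec n" "f i \<in> carrier_vec n" using insert.prems N by (auto simp: submod_def)
  then show ?case using insert N by (simp add: finsum_vec_insert submod_def)
qed

lemma finsum_vec_carrier:
  assumes "\<And>i. i \<in> S \<Longrightarrow> f i \<in> carrier_vec n"
  shows "finsum_vec TYPE('a::comm_monoid_add) n f S \<in> carrier_vec n"
  using assms by (intro finsum_vec_closed) auto

lemma finsum_vec_index:
  assumes "finite S" "i < n" "\<And>s. s \<in> S \<Longrightarrow> f s \<in> carrier_vec n"
  shows "finsum_vec TYPE('a::comm_monoid_add) n f S $ i = (\<Sum>s\<in>S. f s $ i)"
  using assms by (intro index_finsum_vec) auto

lemma finsum_vec_cong: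
  assumes "\<And>i. i \<in> S \<Longrightarrow> f i = g i" "\<And>i. i \<in> S \<Longrightarrow> g i \<in> carrier_vec n"
  shows "finsum_vec TYPE('a::comm_monoid_add) n f S = finsum_vec TYPE('a) n g S"
  unfolding finsum_vec_def using assms
  by (intro comm_monoid.finprod_cong'[OF comm_monoid_vec]) (auto simp: monoid_vec_def)

text \<open>Krylov spaces number their generators from 1, whereas the module image numbers its
  summands from 0.\<close>

lemma finsum_vec_shift:
  assumes "\<And>j. j \<in> {1..m::nat} \<Longrightarrow> f j \<in> carrier_vec n"
  shows "finsum_vec TYPE('a::comm_monoid_add) n f {1..m} = finsum_vec TYPE('a) n (\<lambda>j. f (Suc j)) {..<m}"
proof (rule eq_vecI)
  have S: "f (Suc j) \<in> carrier_vec n" if "j \<in> {..<m}" for j using assms that by auto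
  have d: "dim_vec (finsum_vec TYPE('a) n (\<lambda>j. f (Suc j)) {..<m}) = n"
    by (rule carrier_vecD[OF finsum_vec_carrier[OF S]])
  show "dim_vec (finsum_vec TYPE('a) n f {1..m}) = dim_vec (finsum_vec TYPE('a) n (\<lambda>j. f (Suc j)) {..<m})"
    unfolding d by (rule carrier_vecD[OF finsum_vec_carrier[OF assms]])
  fix i assume "i < dim_vec (finsum_vec TYPE('a) n (\<lambda>j. f (Suc j)) {..<m})"
  then have i: "i < n" by (simp only: d)
  have "finsum_vec TYPE('a) n f {1..m} $ i = (\<Sum>j\<in>{1..m}. f j $ i)"
    by (rule finsum_vec_index[OF _ i assms]) simp
  also have "\<dots> = (\<Sum>j<m. f (Suc j) $ i)" by (simp add: sum.atLeast1_atMost_eq)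
  also have "\<dots> = finsum_vec TYPE('a) n (\<lambda>j. f (Suc j)) {..<m} $ i"
    by (rule finsum_vec_index[OF _ i S, symmetric]) simp
  finally show "finsum_vec TYPE('a) n f {1..m} $ i = finsum_vec TYPE('a) n (\<lambda>j. f (Suc j)) {..<m} $ i" .
qed

lemma mult_mat_vec_finsum:
  fixes A :: "'a::comm_ring_1 mat"
  assumes A: "A \<in> carrier_mat m n" and "finite S" "\<And>i. i \<in> S \<Longrightarrow> f i \<in> carrier_vec n"
  shows "A *\<^sub>v finsum_vec TYPE('a) n f S = finsum_vec TYPE('a) m (\<lambda>i. A *\<^sub>v f i) S"
  using assms(2,3)
proof (induction S rule: finite_induct)
  case empty
  then show ?case by (simp add: finsum_vec_empty mult_mat_zero_vec[OF A])
next
  case (insert i S)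
  have f: "f \<in> S \<rightarrow> carrier_vec n" "f i \<in> carrier_vec n" using insert.prems by auto
  have Af: "(\<lambda>i. A *\<^sub>v f i) \<in> S \<rightarrow> carrier_vec m" "A *\<^sub>v f i \<in> carrier_vec m"
    using f by (auto simp: Pi_iff intro!: mult_mat_vec_carrier[OF A])
  have "finsum_vec TYPE('a) n f (insert i S) = f i + finsum_vec TYPE('a) n f S"
    using insert.hyps f by (intro finsum_vec_insert) auto
  moreover have "finsum_vec TYPE('a) m (\<lambda>i. A *\<^sub>v f i) (insert i S) =
      A *\<^sub>v f i + finsum_vec TYPE('a) m (\<lambda>i. A *\<^sub>v f i) S"
    using insert.hyps Af by (intro finsum_vec_insert) auto
  moreover have "A *\<^sub>v (f i + finsum_vec TYPE('a) n f S) = A *\<^sub>v f i + A *\<^sub>v finsum_vec TYPE('a) n f S"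
    using f by (intro mult_add_distrib_mat_vec[OF A] finsum_vec_closed) auto
  ultimately show ?case using insert by simp
qed

lemma map_vec_finsum:
  assumes "finite S" "\<And>i. i \<in> S \<Longrightarrow> f i \<in> carrier_vec n"
  shows "map_vec to_fract (finsum_vec TYPE('a::idom) n f S) =
    finsum_vec TYPE('a fract) n (\<lambda>i. map_vec to_fract (f i)) S"
proof (rule eq_vecI)
  have d: "dim_vec (finsum_vec TYPE('a) n f S) = n"
    by (rule carrier_vecD[OF finsum_vec_carrier]) (rule assms(2))
  have d': "dim_vec (finsum_vec TYPE('a fract) n (\<lambda>i. map_vec to_fract (f i)) S) = n"
    by (rule carrier_vecD[OF finsum_vec_carrier]) (use assms(2) in simp)
  show "dim_vec (map_vec to_fract (finsum_vec TYPE('a) n f S)) =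
      dim_vec (finsum_vec TYPE('a fract) n (\<lambda>i. map_vec to_fract (f i)) S)" using d d' by simp
  fix i assume "i < dim_vec (finsum_vec TYPE('a fract) n (\<lambda>i. map_vec to_fract (f i)) S)"
  then have i: "i < n" using d' by simp
  have dim: "dim_vec (f s) = n" if "s \<in> S" for s using assms(2)[OF that] by simp
  have "map_vec to_fract (finsum_vec TYPE('a) n f S) $ i = to_fract (\<Sum>s\<in>S. f s $ i)"
    using i d assms by (simp add: finsum_vec_index)
  also have "\<dots> = (\<Sum>s\<in>S. map_vec to_fract (f s) $ i)"
    unfolding to_fract.hom_sum using i dim by (intro sum.cong) auto
  also have "\<dots> = finsum_vec TYPE('a fract) n (\<lambda>i. map_vec to_fract (f i)) S $ i"
    using i assms by (subst finsum_vec_index) auto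
  finally show "map_vec to_fract (finsum_vec TYPE('a) n f S) $ i =
      finsum_vec TYPE('a fract) n (\<lambda>i. map_vec to_fract (f i)) S $ i" .
qed

lemma mult_mat_vec_eq_finsum_cols:
  fixes A :: "'a::comm_ring_1 mat"
  assumes A: "A \<in> carrier_mat m n" and v: "v \<in> carrier_vec n"
  shows "A *\<^sub>v v = finsum_vec TYPE('a) m (\<lambda>c. v $ c \<cdot>\<^sub>v col A c) {..<n}"
proof (rule eq_vecI)
  have c: "v $ c \<cdot>\<^sub>v col A c \<in> carrier_vec m" for c
    by (rule carrier_vecI) (use A in simp)
  then have d: "dim_vec (finsum_vec TYPE('a) m (\<lambda>c. v $ c \<cdot>\<^sub>v col A c) {..<n}) = m"
    by (intro carrier_vecD[OF finsum_vec_carrier])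
  then show "dim_vec (A *\<^sub>v v) = dim_vec (finsum_vec TYPE('a) m (\<lambda>c. v $ c \<cdot>\<^sub>v col A c) {..<n})"
    using A by simp
  fix i assume "i < dim_vec (finsum_vec TYPE('a) m (\<lambda>c. v $ c \<cdot>\<^sub>v col A c) {..<n})"
  then have i: "i < m" using d by simp
  show "(A *\<^sub>v v) $ i = finsum_vec TYPE('a) m (\<lambda>c. v $ c \<cdot>\<^sub>v col A c) {..<n} $ i"
    using i A v c by (subst finsum_vec_index) (auto simp: scalar_prod_def atLeast0LessThan mult.commute)
qed

lemma col_eq_mult_unit_vec:
  fixes A :: "'a::comm_ring_1 mat"
  assumes "A \<in> carrier_mat m n" "c < n"
  shows "col A c = A *\<^sub>v unit_vec n c"
  using assms by (intro eq_vecI) auto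

section \<open>Krylov spaces\<close>

lemma krylov_term_carrier:
  fixes M :: "'a::idom mat"
  assumes "M \<in> carrier_mat n n" "w j \<in> carrier_vec n"
  shows "c i j \<cdot>\<^sub>v (M ^\<^sub>m i *\<^sub>v w j) \<in> carrier_vec n"
  using mult_mat_vec_carrier[OF pow_carrier_mat[OF assms(1)] assms(2)] by simp

lemma krylov_sum_carrier:
  fixes M :: "'a::idom mat" and m :: nat
  assumes "M \<in> carrier_mat n n" "\<And>j. j \<in> {1..m} \<Longrightarrow> w j \<in> carrier_vec n"
  shows "finsum_vec TYPE('a) n
    (\<lambda>j. finsum_vec TYPE('a) n (\<lambda>i. c i j \<cdot>\<^sub>v ((M ^\<^sub>m i) *\<^sub>v w j)) {0..<n}) {1..m} \<in> carrier_vec n"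
  using assms by (intro finsum_vec_carrier krylov_term_carrier) auto

lemma krylov_sum_index:
  fixes M :: "'a::idom mat" and m :: nat
  assumes "M \<in> carrier_mat n n" "\<And>j. j \<in> {1..m} \<Longrightarrow> w j \<in> carrier_vec n" "r < n"
  shows "finsum_vec TYPE('a) n
      (\<lambda>j. finsum_vec TYPE('a) n (\<lambda>i. c i j \<cdot>\<^sub>v ((M ^\<^sub>m i) *\<^sub>v w j)) {0..<n}) {1..m} $ r =
    (\<Sum>j\<in>{1..m}. \<Sum>i\<in>{0..<n}. c i j * (M ^\<^sub>m i *\<^sub>v w j) $ r)"
proof -
  have t: "c i j \<cdot>\<^sub>v (M ^\<^sub>m i *\<^sub>v w j) \<in> carrier_vec n" if "j \<in> {1..m}" for i j
    by (rule krylov_term_carrier[where w = w and j = j, OF assms(1) assms(2)[OF that]])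
  have d: "dim_row (M ^\<^sub>m i) = n" for i using assms(1) by simp
  have "finsum_vec TYPE('a) n
      (\<lambda>j. finsum_vec TYPE('a) n (\<lambda>i. c i j \<cdot>\<^sub>v ((M ^\<^sub>m i) *\<^sub>v w j)) {0..<n}) {1..m} $ r =
    (\<Sum>j\<in>{1..m}. finsum_vec TYPE('a) n (\<lambda>i. c i j \<cdot>\<^sub>v ((M ^\<^sub>m i) *\<^sub>v w j)) {0..<n} $ r)"
    using t assms(3) by (intro finsum_vec_index finsum_vec_carrier) auto
  also have "\<dots> = (\<Sum>j\<in>{1..m}. \<Sum>i\<in>{0..<n}. (c i j \<cdot>\<^sub>v ((M ^\<^sub>m i) *\<^sub>v w j)) $ r)"
    using t assms(3) by (intro sum.cong refl finsum_vec_index) auto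
  also have "\<dots> = (\<Sum>j\<in>{1..m}. \<Sum>i\<in>{0..<n}. c i j * (M ^\<^sub>m i *\<^sub>v w j) $ r)"
    using assms(3) d by (intro sum.cong refl) (simp del: index_mult_mat_vec)
  finally show ?thesis .
qed

lemma submod_krylov:
  fixes M :: "'a::idom mat"
  assumes M: "M \<in> carrier_mat n n" and w: "\<And>j. j \<in> {1..m} \<Longrightarrow> w j \<in> carrier_vec n"
  shows "submod n (krylov n M m w)"
proof -
  define K where "K c = finsum_vec TYPE('a) n
    (\<lambda>j. finsum_vec TYPE('a) n (\<lambda>i. c i j \<cdot>\<^sub>v ((M ^\<^sub>m i) *\<^sub>v w j)) {0..<n}) {1..m}" for c
  have K: "krylov n M m w = range K" unfolding krylov_def K_def by blast
  have Kc: "K c \<in> carrier_vec n" for c unfolding K_def by (rule krylov_sum_carrier[OF M w])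
  have Ki: "K c $ r = (\<Sum>j\<in>{1..m}. \<Sum>i\<in>{0..<n}. c i j * (M ^\<^sub>m i *\<^sub>v w j) $ r)" if "r < n" for c r
    unfolding K_def by (rule krylov_sum_index[OF M w that])
  have d: "dim_vec (K c) = n" for c using Kc[of c] by simp
  have "0\<^sub>v n = K (\<lambda>_ _. 0)" by (rule eq_vecI) (simp_all add: Ki d)
  moreover have "K c + K c' = K (\<lambda>i j. c i j + c' i j)" for c c'
    by (rule eq_vecI) (simp_all add: Ki d sum.distrib distrib_right del: index_mult_mat_vec)
  moreover have "a \<cdot>\<^sub>v K c = K (\<lambda>i j. a * c i j)" for a c
    by (rule eq_vecI) (simp_all add: Ki d sum_distrib_left mult.assoc del: index_mult_mat_vec)
  ultimately show ?thesis unfolding submod_def K using Kc by auto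
qed

lemma krylov_generator:
  fixes M :: "'a::idom mat"
  assumes M: "M \<in> carrier_mat n n" and w: "\<And>j. j \<in> {1..m} \<Longrightarrow> w j \<in> carrier_vec n"
    and n: "n > 0" and j: "j \<in> {1..m}"
  shows "w j \<in> krylov n M m w"
proof -
  \<comment> \<open>Only the term X^0 w_j is kept; the index i = 0 is available because n >
    0.\<close>
  let ?c = "\<lambda>i j'. if i = 0 \<and> j' = j then 1 else 0 :: 'a"
  let ?K = "finsum_vec TYPE('a) n
    (\<lambda>j. finsum_vec TYPE('a) n (\<lambda>i. ?c i j \<cdot>\<^sub>v ((M ^\<^sub>m i) *\<^sub>v w j)) {0..<n}) {1..m}"
  have d: "dim_vec ?K = n" 
    by (rule carrier_vecD[OF krylov_sum_carrier[where c = ?c and w = w and m = m, OF M w]])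
  have "w j = ?K"
  proof (rule eq_vecI)
    fix r assume "r < dim_vec ?K"
    then have r: "r < n" using d by simp
    have "?K $ r = (\<Sum>j'\<in>{1..m}. \<Sum>i\<in>{0..<n}. ?c i j' * (M ^\<^sub>m i *\<^sub>v w j') $ r)"
      by (rule krylov_sum_index[OF M w r])
    also have "\<dots> = (\<Sum>j'\<in>{1..m}. if j' = j then (M ^\<^sub>m 0 *\<^sub>v w j') $ r else 0)"
    proof (rule sum.cong[OF refl])
      fix j'
      have "(\<Sum>i\<in>{0..<n}. ?c i j' * (M ^\<^sub>m i *\<^sub>v w j') $ r) =
          (\<Sum>i\<in>{0..<n}. if i = 0 then if j' = j then (M ^\<^sub>m 0 *\<^sub>v w j') $ r else 0 else 0)"
        by (intro sum.cong) auto
      then show "(\<Sum>i\<in>{0..<n}. ?c i j' * (M ^\<^sub>m i *\<^sub>v w j') $ r) =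
          (if j' = j then (M ^\<^sub>m 0 *\<^sub>v w j') $ r else 0)"
        using n by simp
    qed
    also have "\<dots> = (M ^\<^sub>m 0 *\<^sub>v w j) $ r" using j by simp
    also have "\<dots> = w j $ r" using M w[OF j] by simp
    finally show "w j $ r = ?K $ r" by simp
  qed (simp only: d carrier_vecD[OF w[OF j]])
  then show ?thesis unfolding krylov_def by (intro CollectI exI[of _ ?c] conjI TrueI)
qed

lemma krylov_in_ideal:
  fixes M :: "'a::idom mat"
  assumes I: "ideal I class_ring" and M: "M \<in> carrier_mat n n"
    and w: "\<And>j. j \<in> {1..m} \<Longrightarrow> w j \<in> carrier_vec n" "\<And>j. j \<in> {1..m} \<Longrightarrow> vec_cong0 (w j) I"
    and q: "q \<in> krylov n M m w" and r: "r < n"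
  shows "q $ r \<in> I"
proof -
  obtain c where q: "q = finsum_vec TYPE('a) n
      (\<lambda>j. finsum_vec TYPE('a) n (\<lambda>i. c i j \<cdot>\<^sub>v ((M ^\<^sub>m i) *\<^sub>v w j)) {0..<n}) {1..m}"
    using q unfolding krylov_def by blast
  have "(M ^\<^sub>m i *\<^sub>v w j) $ r \<in> I" if j: "j \<in> {1..m}" for i j
    by (rule mult_mat_vec_in_ideal[OF I pow_carrier_mat[OF M] w(1)[OF j] _ r])
      (use w[OF j] in \<open>auto simp: vec_cong0_def\<close>)
  moreover have "q $ r = (\<Sum>j\<in>{1..m}. \<Sum>i\<in>{0..<n}. c i j * (M ^\<^sub>m i *\<^sub>v w j) $ r)"
    unfolding q by (rule krylov_sum_index[where w = w and m = m, OF M w(1) r])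
  ultimately show ?thesis
    by (auto intro!: class_ideal_sum[OF I] intro: class_ideal_mult[OF I] simp del: index_mult_mat_vec)
qed

section \<open>The lattice of an intertwiner\<close>

lemma common_denominator:
  fixes S :: "'a::idom fract set"
  assumes "finite S"
  shows "\<exists>d. d \<noteq> 0 \<and> (\<forall>x\<in>S. to_fract d * x \<in> range to_fract)"
  using assms
proof (induction S rule: finite_induct)
  case (insert x S)
  obtain d where "d \<noteq> 0 \<and> (\<forall>x\<in>S. to_fract d * x \<in> range to_fract)"
    using insert.IH by (rule exE)
  then have d: "d \<noteq> 0" "\<forall>x\<in>S. to_fract d * x \<in> range to_fract" by simp_all
  obtain a b where b: "x = Fraction_Field.Fract a b" "b \<noteq> 0" by (cases x) auto
  have x: "to_fract b * x = to_fract a" using b by (simp add: Fract_conv_to_fract)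
  have "to_fract (b * d) * x = to_fract (d * a)" by (simp add: x[symmetric] mult_ac)
  then have "to_fract (b * d) * x \<in> range to_fract" by (rule range_eqI)
  moreover have "to_fract (b * d) * y \<in> range to_fract" if y: "y \<in> S" for y
  proof -
    obtain z where "to_fract d * y = to_fract z" using bspec[OF d(2) y] by (rule rangeE)
    then have "to_fract (b * d) * y = to_fract (b * z)" by (simp add: mult.assoc)
    then show ?thesis by blast
  qed
  ultimately show ?case using d(1) b(2) by (intro exI[of _ "b * d"]) (auto simp del: to_fract_mult)
qed (auto intro: exI[of _ 1])

lemma level_iff:
  fixes Q :: "'a::idom fract mat"
  assumes Q: "Q \<in> carrier_mat n n"
  shows "r \<in> level n Q \<longleftrightarrow> (\<forall>i<n. \<forall>j<n. to_fract r * Q $$ (i,j) \<in> range to_fract)"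
proof
  assume "r \<in> level n Q"
  then obtain N where N: "N \<in> carrier_mat n n" "to_fract r \<cdot>\<^sub>m Q = map_mat to_fract N"
    unfolding level_def integral_mats_def by blast
  show "\<forall>i<n. \<forall>j<n. to_fract r * Q $$ (i,j) \<in> range to_fract"
  proof (intro allI impI)
    fix i j assume ij: "i < n" "j < n"
    have "to_fract r * Q $$ (i,j) = to_fract (N $$ (i,j))"
      using arg_cong[OF N(2), of "\<lambda>A. A $$ (i,j)"] ij N(1) Q by simp
    then show "to_fract r * Q $$ (i,j) \<in> range to_fract" by (rule range_eqI)
  qed
next
  assume *: "\<forall>i<n. \<forall>j<n. to_fract r * Q $$ (i,j) \<in> range to_fract"
  define N where "N = mat n n (\<lambda>(i,j). SOME z. to_fract z = to_fract r * Q $$ (i,j))"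
  have "to_fract (SOME z. to_fract z = to_fract r * Q $$ (i,j)) = to_fract r * Q $$ (i,j)" if "i < n" "j < n" for i j
    by (rule someI_ex) (use * that in \<open>metis rangeE\<close>)
  then have "to_fract r \<cdot>\<^sub>m Q = map_mat to_fract N" using Q by (intro eq_matI) (auto simp: N_def)
  then show "r \<in> level n Q" unfolding level_def integral_mats_def by (auto simp: N_def)
qed

lemma ideal_level:
  fixes Q :: "'a::idom fract mat"
  assumes Q: "Q \<in> carrier_mat n n"
  shows "ideal (level n Q) class_ring"
proof (rule class_idealI)
  show "0 \<in> level n Q" unfolding level_iff[OF Q] by (auto intro: range_eqI[of _ _ 0])
next
  fix a b assume ab: "a \<in> level n Q" "b \<in> level n Q"
  show "a + b \<in> level n Q" unfolding level_iff[OF Q]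
  proof (intro allI impI)
    fix i j assume "i < n" "j < n"
    then obtain x y where "to_fract a * Q $$ (i,j) = to_fract x" "to_fract b * Q $$ (i,j) = to_fract y"
      using ab unfolding level_iff[OF Q] by blast
    then have "to_fract (a + b) * Q $$ (i,j) = to_fract (x + y)" by (simp add: distrib_right)
    then show "to_fract (a + b) * Q $$ (i,j) \<in> range to_fract" by blast
  qed
next
  fix r a assume a: "a \<in> level n Q"
  show "r * a \<in> level n Q" unfolding level_iff[OF Q]
  proof (intro allI impI)
    fix i j assume "i < n" "j < n"
    then obtain x where "to_fract a * Q $$ (i,j) = to_fract x"
      using a unfolding level_iff[OF Q] by blast
    then have "to_fract (r * a) * Q $$ (i,j) = to_fract (r * x)" by (simp add: mult.assoc)
    then show "to_fract (r * a) * Q $$ (i,j) \<in> range to_fract" by blast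
  qed
qed

lemma level_nonzero:
  fixes Q :: "'a::idom fract mat"
  assumes Q: "Q \<in> carrier_mat n n"
  shows "level n Q \<noteq> {0}"
proof -
  have "finite ((\<lambda>(i,j). Q $$ (i,j)) ` ({..<n} \<times> {..<n}))" by simp
  from common_denominator[OF this] obtain d where d: "d \<noteq> 0"
    "\<forall>x\<in>(\<lambda>(i,j). Q $$ (i,j)) ` ({..<n} \<times> {..<n}). to_fract d * x \<in> range to_fract" by (elim exE conjE)
  have "d \<in> level n Q" unfolding level_iff[OF Q]
  proof (intro allI impI)
    fix i j assume "i < n" "j < n"
    then have "Q $$ (i,j) \<in> (\<lambda>(i,j). Q $$ (i,j)) ` ({..<n} \<times> {..<n})" by force
    then show "to_fract d * Q $$ (i,j) \<in> range to_fract" by (rule bspec[OF d(2)])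
  qed
  then show ?thesis using d(1) by blast
qed

text \<open>The matrix l Q pulled back to R. For l in the level the choice is unique, because
  \<open>to_fract\<close> is injective; for other l some entries are arbitrary.\<close>

definition level_mat :: "nat \<Rightarrow> 'a::idom fract mat \<Rightarrow> 'a \<Rightarrow> 'a mat" where
  "level_mat n Q l = mat n n (\<lambda>(i,j). SOME z. to_fract z = to_fract l * Q $$ (i,j))"

lemma level_mat_carrier [simp]: "level_mat n Q l \<in> carrier_mat n n"
  by (simp add: level_mat_def)

lemma to_fract_level_mat_index:
  assumes Q: "Q \<in> carrier_mat n n" and l: "l \<in> level n Q" and "i < n" "j < n"
  shows "to_fract (level_mat n Q l $$ (i,j)) = to_fract l * Q $$ (i,j)"
proof -
  have "to_fract (SOME z. to_fract z = to_fract l * Q $$ (i,j)) = to_fract l * Q $$ (i,j)"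
    by (rule someI_ex) (use assms level_iff[OF Q] in \<open>metis rangeE\<close>)
  then show ?thesis using assms by (simp add: level_mat_def)
qed

lemma map_level_mat:
  assumes Q: "Q \<in> carrier_mat n n" and l: "l \<in> level n Q"
  shows "map_mat to_fract (level_mat n Q l) = to_fract l \<cdot>\<^sub>m Q"
  using to_fract_level_mat_index[OF assms] Q by (intro eq_matI) (auto simp: level_mat_def)

lemma map_level_mat_mult_vec:
  assumes Q: "Q \<in> carrier_mat n n" and l: "l \<in> level n Q" and v: "v \<in> carrier_vec n"
  shows "map_vec to_fract (level_mat n Q l *\<^sub>v v) = to_fract l \<cdot>\<^sub>v (Q *\<^sub>v map_vec to_fract v)"
proof -
  have "map_vec to_fract (level_mat n Q l *\<^sub>v v) = (to_fract l \<cdot>\<^sub>m Q) *\<^sub>v map_vec to_fract v"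
    using to_fract.mult_mat_vec_hom[OF level_mat_carrier v] map_level_mat[OF Q l] by metis
  also have "\<dots> = to_fract l \<cdot>\<^sub>v (Q *\<^sub>v map_vec to_fract v)"
    using Q v by (intro eq_vecI) auto
  finally show ?thesis .
qed

lemma level_mat_intertwines:
  fixes M Y :: "'a::idom mat"
  assumes M: "M \<in> carrier_mat n n" and Y: "Y \<in> carrier_mat n n" and Q: "Q \<in> carrier_mat n n"
    and XQ: "map_mat to_fract M * Q = Q * map_mat to_fract Y" and l: "l \<in> level n Q"
  shows "M * level_mat n Q l = level_mat n Q l * Y"
proof -
  have cX: "map_mat to_fract M \<in> carrier_mat n n" and cY: "map_mat to_fract Y \<in> carrier_mat n n"
    using M Y by auto
  have "map_mat to_fract (M * level_mat n Q l) = map_mat to_fract M * (to_fract l \<cdot>\<^sub>m Q)"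
    using to_fract.mat_hom_mult[OF M level_mat_carrier] map_level_mat[OF Q l] by metis
  also have "\<dots> = to_fract l \<cdot>\<^sub>m (Q * map_mat to_fract Y)"
    by (simp only: mult_smult_distrib[OF cX Q] XQ)
  also have "\<dots> = (to_fract l \<cdot>\<^sub>m Q) * map_mat to_fract Y" by (simp only: mult_smult_assoc_mat[OF Q cY])
  also have "\<dots> = map_mat to_fract (level_mat n Q l * Y)"
    using to_fract.mat_hom_mult[OF level_mat_carrier Y] map_level_mat[OF Q l] by metis
  finally show ?thesis by (rule to_fract.mat_hom_inj)
qed

text \<open>Powers of M can be moved past l Q, where they become powers of Y. A vector of the form l
  Q v therefore keeps this form, with the same l, under M.\<close>

lemma level_mat_intertwines_pow:
  fixes M Y :: "'a::idom mat"
  assumes M: "M \<in> carrier_mat n n" and Y: "Y \<in> carrier_mat n n" and Q: "Q \<in> carrier_mat n n"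
    and XQ: "map_mat to_fract M * Q = Q * map_mat to_fract Y" and l: "l \<in> level n Q"
    and v: "v \<in> carrier_vec n"
  shows "M ^\<^sub>m i *\<^sub>v (level_mat n Q l *\<^sub>v v) = level_mat n Q l *\<^sub>v (Y ^\<^sub>m i *\<^sub>v v)"
  using v
proof (induction i arbitrary: v)
  case 0
  then show ?case using M Y mult_mat_vec_carrier[OF level_mat_carrier[of n Q l], of v] by simp
next
  case (Suc i)
  have Yv: "Y *\<^sub>v v \<in> carrier_vec n" using Y Suc.prems by simp
  have "M ^\<^sub>m Suc i *\<^sub>v (level_mat n Q l *\<^sub>v v) = M ^\<^sub>m i *\<^sub>v (M *\<^sub>v (level_mat n Q l *\<^sub>v v))"
    by (rule pow_mat_mult_vec[OF M mult_mat_vec_carrier[OF level_mat_carrier Suc.prems]])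
  also have "M *\<^sub>v (level_mat n Q l *\<^sub>v v) = (M * level_mat n Q l) *\<^sub>v v"
    by (rule assoc_mult_mat_vec[OF M level_mat_carrier Suc.prems, symmetric])
  also have "\<dots> = level_mat n Q l *\<^sub>v (Y *\<^sub>v v)"
    unfolding level_mat_intertwines[OF M Y Q XQ l]
    by (rule assoc_mult_mat_vec[OF level_mat_carrier Y Suc.prems])
  also have "M ^\<^sub>m i *\<^sub>v (level_mat n Q l *\<^sub>v (Y *\<^sub>v v)) = level_mat n Q l *\<^sub>v (Y ^\<^sub>m i *\<^sub>v (Y *\<^sub>v v))"
    by (rule Suc.IH[OF Yv])
  also have "Y ^\<^sub>m i *\<^sub>v (Y *\<^sub>v v) = Y ^\<^sub>m Suc i *\<^sub>v v" by (rule pow_mat_mult_vec[OF Y Suc.prems, symmetric])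
  finally show ?case .
qed

text \<open>The product of (l Q)^T and l' Q is l l' times the integral matrix Q^T Q. With l and l'
  in P^e this is the source of the exponent 2e.\<close>

lemma level_mat_scalar_prod_dvd:
  fixes Q :: "'a::idom fract mat"
  assumes Q: "Q \<in> carrier_mat n n" and QQ: "transpose_mat Q * Q \<in> integral_mats n"
    and l: "l \<in> level n Q" "l' \<in> level n Q" and v: "v \<in> carrier_vec n" "v' \<in> carrier_vec n"
  shows "l * l' dvd (level_mat n Q l *\<^sub>v v) \<bullet> (level_mat n Q l' *\<^sub>v v')"
proof -
  let ?N = "level_mat n Q l" and ?N' = "level_mat n Q l'"
  obtain Z where Z: "Z \<in> carrier_mat n n" "transpose_mat Q * Q = map_mat to_fract Z"
    using QQ unfolding integral_mats_def by blast
  have NT: "transpose_mat ?N \<in> carrier_mat n n" by simp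
  have QT: "transpose_mat Q \<in> carrier_mat n n" using Q by simp
  have T: "map_mat to_fract (transpose_mat ?N) = to_fract l \<cdot>\<^sub>m transpose_mat Q"
  proof -
    have "map_mat to_fract (transpose_mat ?N) = transpose_mat (map_mat to_fract ?N)"
      by (intro eq_matI) auto
    then show ?thesis unfolding map_level_mat[OF Q l(1)] by (auto simp: mat_eq_iff)
  qed
  have "map_mat to_fract (transpose_mat ?N * ?N') =
      (to_fract l \<cdot>\<^sub>m transpose_mat Q) * (to_fract l' \<cdot>\<^sub>m Q)"
    unfolding to_fract.mat_hom_mult[OF NT level_mat_carrier] T map_level_mat[OF Q l(2)] ..
  also have "\<dots> = to_fract l \<cdot>\<^sub>m (to_fract l' \<cdot>\<^sub>m map_mat to_fract Z)"
    unfolding mult_smult_assoc_mat[OF QT smult_carrier_mat[OF Q]] mult_smult_distrib[OF QT Q] Z(2) ..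
  also have "\<dots> = map_mat to_fract ((l * l') \<cdot>\<^sub>m Z)"
    by (intro eq_matI) auto
  finally have NN: "transpose_mat ?N * ?N' = (l * l') \<cdot>\<^sub>m Z" by (rule to_fract.mat_hom_inj)
  have "(?N *\<^sub>v v) \<bullet> (?N' *\<^sub>v v') = (transpose_mat ?N *\<^sub>v (?N' *\<^sub>v v')) \<bullet> v"
    using transpose_vec_mult_scalar[OF level_mat_carrier v(1), of "?N' *\<^sub>v v'"]
      comm_scalar_prod[of "?N *\<^sub>v v" n "?N' *\<^sub>v v'"] v
      mult_mat_vec_carrier[OF level_mat_carrier v(1)] mult_mat_vec_carrier[OF level_mat_carrier v(2)] by metis
  also have "transpose_mat ?N *\<^sub>v (?N' *\<^sub>v v') = ((l * l') \<cdot>\<^sub>m Z) *\<^sub>v v'"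
    unfolding NN[symmetric] by (rule assoc_mult_mat_vec[OF NT level_mat_carrier v(2), symmetric])
  also have "\<dots> = (l * l') \<cdot>\<^sub>v (Z *\<^sub>v v')" using Z(1) v by (intro eq_vecI) auto
  also have "\<dots> \<bullet> v = (l * l') * ((Z *\<^sub>v v') \<bullet> v)"
    using Z(1) v by (intro smult_scalar_prod_distrib) auto
  finally show ?thesis by simp
qed

text \<open>This reduces orthogonality of a whole module to orthogonality of its generators.\<close>

lemma submod_orthogonal:
  fixes I :: "'a::idom set"
  assumes I: "ideal I class_ring" and B: "B \<subseteq> carrier_vec n"
  shows "submod n {q \<in> carrier_vec n. \<forall>b\<in>B. q \<bullet> b \<in> I}"
proof -
  have "(v + w) \<bullet> b = v \<bullet> b + w \<bullet> b" "(c \<cdot>\<^sub>v v) \<bullet> b = c * (v \<bullet> b)"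
    if "v \<in> carrier_vec n" "w \<in> carrier_vec n" "b \<in> B" for v w b c
  proof -
    have b: "b \<in> carrier_vec n" using that B by blast
    show "(v + w) \<bullet> b = v \<bullet> b + w \<bullet> b" by (rule add_scalar_prod_distrib[OF that(1,2) b])
    show "(c \<cdot>\<^sub>v v) \<bullet> b = c * (v \<bullet> b)" by (rule smult_scalar_prod_distrib[OF that(1) b])
  qed
  moreover have "0\<^sub>v n \<bullet> b = 0" if "b \<in> B" for b using that B by (auto intro: scalar_prod_left_zero)
  ultimately show ?thesis
    unfolding submod_def using class_ideal_zero[OF I] class_ideal_add[OF I] class_ideal_mult[OF I] by auto
qed

text \<open>Contractivity is tested on one q at a time, and isotropy is used only between q and the
  vectors M^j q, which stay in N. Locally q = \<pi>^k u, and the task is to carry isotropy from q to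
  u and the conclusion back from u to q.\<close>

lemma contractive_of_isotropic:
  fixes M :: "'a::idom mat"
  assumes D: "dedekind_domain TYPE('a)" and M: "M \<in> carrier_mat n n" "transpose_mat M = M"
    and P: "primeideal P class_ring" "P \<noteq> {0}" and \<Gamma>: "is_approx_sqrt P M \<Gamma>"
    and N: "N \<subseteq> carrier_vec n" "\<And>q. q \<in> N \<Longrightarrow> M *\<^sub>v q \<in> N" and iso: "isotropic (ideal_pow P (2 * e)) N"
  shows "contractive n M \<Gamma> P e N"
  unfolding contractive_def
proof (intro allI impI ballI)
  fix g k q
  assume g: "reduce_poly P g = \<Gamma>" and k: "k < e" and q: "q \<in> N" and qk: "vec_cong0 q (ideal_pow P k)"
  have I: "ideal P class_ring" using P by (simp add: primeideal_def)
  have max: "maximalideal P class_ring" using D P unfolding dedekind_domain_def by blast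
  obtain \<pi> s where ps: "\<pi> \<in> P" "\<pi> \<noteq> 0" "s \<notin> P" "\<And>y. y \<in> P \<Longrightarrow> \<pi> dvd s * y"
    using dedekind_local_uniformizer[OF D P] by blast
  have qc: "q \<in> carrier_vec n" using q N by blast
  then have "\<exists>z. s ^ k * q $ i = \<pi> ^ k * z" if "i < n" for i
    using ideal_pow_dvd[OF I ps(4), of "q $ i" k] qk that unfolding vec_cong0_def dvd_def by auto
  then obtain z where z: "\<And>i. i < n \<Longrightarrow> s ^ k * q $ i = \<pi> ^ k * z i" by metis
  define u where "u = vec n z"
  have u: "u \<in> carrier_vec n" by (simp add: u_def)
  have qu: "s ^ k \<cdot>\<^sub>v q = \<pi> ^ k \<cdot>\<^sub>v u" using qc z by (intro eq_vecI) (auto simp: u_def)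
  have pow: "M ^\<^sub>m j \<in> carrier_mat n n" for j using M(1) by simp
  have iso_u: "u \<bullet> (M ^\<^sub>m j *\<^sub>v u) \<in> P" for j
  proof -
    have "M ^\<^sub>m j *\<^sub>v v \<in> N" if "v \<in> N" for v
      using that
    proof (induction j arbitrary: v)
      case 0
      then show ?case using N M by (auto simp: subset_iff)
    next
      case (Suc j)
      have "v \<in> carrier_vec n" using Suc.prems N by blast
      then show ?case using Suc N(2) by (simp only: pow_mat_mult_vec[OF M(1)])
    qed
    then have "q \<bullet> (M ^\<^sub>m j *\<^sub>v q) \<in> ideal_pow P (2 * e)" using iso q by (simp add: isotropic_def)
    \<comment> \<open>From k < e follows 2k + 1 \<le> 2e. Replacing q by u removes \<pi>^(2k), so
      exactly the one factor of P needed for u is kept.\<close>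
    moreover have "ideal_pow P (2 * e) \<subseteq> ideal_pow P (2 * k + 1)"
      using k by (intro ideal_pow_antimono[OF I]) simp
    ultimately have qq: "q \<bullet> (M ^\<^sub>m j *\<^sub>v q) \<in> ideal_pow P (2 * k + 1)" by (rule rev_subsetD)
    have bil: "(c \<cdot>\<^sub>v v) \<bullet> (M ^\<^sub>m j *\<^sub>v (c \<cdot>\<^sub>v v)) = c * (c * (v \<bullet> (M ^\<^sub>m j *\<^sub>v v)))"
      if v: "v \<in> carrier_vec n" for c v
    proof -
      have m: "M ^\<^sub>m j *\<^sub>v v \<in> carrier_vec n" by (rule mult_mat_vec_carrier[OF pow v])
      then have "c \<cdot>\<^sub>v (M ^\<^sub>m j *\<^sub>v v) \<in> carrier_vec n" by simp
      then show ?thesis unfolding mult_mat_vec_smult[OF pow v]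
        using smult_scalar_prod_distrib[OF v] scalar_prod_smult_distrib[OF v m] by simp
    qed
    have "\<pi> ^ (2 * k) * (u \<bullet> (M ^\<^sub>m j *\<^sub>v u)) = s ^ (2 * k) * (q \<bullet> (M ^\<^sub>m j *\<^sub>v q))"
      using bil[OF u, of "\<pi> ^ k"] bil[OF qc, of "s ^ k"] qu by (simp add: mult_2 power_add mult.assoc)
    also have "\<dots> \<in> ideal_pow P (2 * k + 1)" by (rule class_ideal_mult[OF ideal_ideal_pow[OF I] qq])
    finally show ?thesis using uniformizer_power_cancel[OF P(1) ps(1-3)] ps(4) by blast
  qed
  show "vec_cong0 (mat_eval n g M *\<^sub>v q) (ideal_pow P (k + 1))"
    unfolding vec_cong0_def
  proof (intro allI impI)
    fix i assume i: "i < dim_vec (mat_eval n g M *\<^sub>v q)"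
    show "(mat_eval n g M *\<^sub>v q) $ i \<in> ideal_pow P (k + 1)"
    proof -
      have G: "mat_eval n g M \<in> carrier_mat n n" by (rule mat_eval_carrier[OF M(1)])
      then have i: "i < n" using i by simp
      have "(mat_eval n g M *\<^sub>v u) $ i \<in> P"
        by (rule approx_sqrt_annihilates_isotropic[OF max M \<Gamma> g u iso_u i])
      \<comment> \<open>Back from u to q: \<pi>^k u = s^k q, so s^k times the desired entry lies in
        P^(k+1), and s^k is outside P.\<close>
      then have "\<pi> ^ k * (mat_eval n g M *\<^sub>v u) $ i \<in> ideal_pow P (k + 1)"
        using ideal_pow_mult[OF I power_in_ideal_pow[OF I ps(1)], of _ 1 k] ideal_pow_1[OF I] by simp
      also have "\<pi> ^ k * (mat_eval n g M *\<^sub>v u) $ i = (mat_eval n g M *\<^sub>v (\<pi> ^ k \<cdot>\<^sub>v u)) $ i"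
        unfolding mult_mat_vec_smult[OF G u] using i G by (simp del: index_mult_mat_vec)
      also have "\<dots> = s ^ k * (mat_eval n g M *\<^sub>v q) $ i"
        unfolding qu[symmetric] mult_mat_vec_smult[OF G qc] using i G by (simp del: index_mult_mat_vec)
      finally show ?thesis by (rule ideal_pow_cancel[OF max class_prime_power[OF P(1) ps(3)]])
    qed
  qed
qed

text \<open>Since \<open>level_mat\<close> is defined by choice, its linearity in l has to be
  checked in the fraction field and pulled back by injectivity.\<close>

lemma level_mat_lincomb_mult_vec:
  fixes Q :: "'a::idom fract mat" and t :: nat
  assumes Q: "Q \<in> carrier_mat n n" and a: "\<And>i. i < t \<Longrightarrow> a i \<in> level n Q" and v: "v \<in> carrier_vec n"
  shows "level_mat n Q (\<Sum>i<t. r i * a i) *\<^sub>v v =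
    finsum_vec TYPE('a) n (\<lambda>i. r i \<cdot>\<^sub>v (level_mat n Q (a i) *\<^sub>v v)) {..<t}"
proof (rule eq_vecI)
  let ?l = "\<Sum>i<t. r i * a i"
  note L = ideal_level[OF Q]
  have l: "?l \<in> level n Q" by (intro class_ideal_sum[OF L] class_ideal_mult[OF L]) (use a in auto)
  have c: "r i \<cdot>\<^sub>v (level_mat n Q (a i) *\<^sub>v v) \<in> carrier_vec n" for i
    using mult_mat_vec_carrier[OF level_mat_carrier v] by simp
  have d: "dim_vec (finsum_vec TYPE('a) n (\<lambda>i. r i \<cdot>\<^sub>v (level_mat n Q (a i) *\<^sub>v v)) {..<t}) = n"
    by (rule carrier_vecD[OF finsum_vec_carrier[OF c]])
  have dr: "dim_row (level_mat n Q l) = n" "dim_col (level_mat n Q l) = n" for l by (simp_all add: level_mat_def)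
  show "dim_vec (level_mat n Q ?l *\<^sub>v v) =
      dim_vec (finsum_vec TYPE('a) n (\<lambda>i. r i \<cdot>\<^sub>v (level_mat n Q (a i) *\<^sub>v v)) {..<t})"
    unfolding d by (simp add: dr)
  fix x assume "x < dim_vec (finsum_vec TYPE('a) n (\<lambda>i. r i \<cdot>\<^sub>v (level_mat n Q (a i) *\<^sub>v v)) {..<t})"
  then have x: "x < n" by (simp only: d)
  have entry: "level_mat n Q ?l $$ (x,y) = (\<Sum>i<t. r i * level_mat n Q (a i) $$ (x,y))" if y: "y < n" for y
  proof -
    have "to_fract (level_mat n Q ?l $$ (x,y)) = (\<Sum>i<t. to_fract (r i) * (to_fract (a i) * Q $$ (x,y)))"
      unfolding to_fract_level_mat_index[OF Q l x y]
      by (simp add: to_fract.hom_sum sum_distrib_right mult.assoc)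
    also have "\<dots> = to_fract (\<Sum>i<t. r i * level_mat n Q (a i) $$ (x,y))"
      unfolding to_fract.hom_sum to_fract_mult
      by (intro sum.cong refl) (use to_fract_level_mat_index[OF Q a x y] in auto)
    finally show ?thesis unfolding to_fract_eq_iff .
  qed
  have mv: "(level_mat n Q l *\<^sub>v v) $ x = (\<Sum>y<n. level_mat n Q l $$ (x,y) * v $ y)" for l
    using x v dr by (simp add: scalar_prod_def atLeast0LessThan)
  have "(level_mat n Q ?l *\<^sub>v v) $ x = (\<Sum>y<n. \<Sum>i<t. r i * (level_mat n Q (a i) $$ (x,y) * v $ y))"
    unfolding mv by (intro sum.cong refl) (simp add: entry sum_distrib_right mult.assoc)
  also have "\<dots> = (\<Sum>i<t. r i * (level_mat n Q (a i) *\<^sub>v v) $ x)"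
    unfolding mv sum_distrib_left by (rule sum.swap)
  also have "\<dots> = (\<Sum>i<t. (r i \<cdot>\<^sub>v (level_mat n Q (a i) *\<^sub>v v)) $ x)"
    by (intro sum.cong refl) (use x dr in \<open>simp del: index_mult_mat_vec\<close>)
  also have "\<dots> = finsum_vec TYPE('a) n (\<lambda>i. r i \<cdot>\<^sub>v (level_mat n Q (a i) *\<^sub>v v)) {..<t} $ x"
    by (rule finsum_vec_index[OF _ x c, symmetric]) simp
  finally show "(level_mat n Q ?l *\<^sub>v v) $ x =
      finsum_vec TYPE('a) n (\<lambda>i. r i \<cdot>\<^sub>v (level_mat n Q (a i) *\<^sub>v v)) {..<t} $ x" .
qed

text \<open>The generators are the columns of \<open>l Q\<close>, where \<open>l\<close> runs through generators of the level.\<close>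

lemma level_krylov:
  fixes M Y :: "'a::idom mat" and Q :: "'a fract mat"
  assumes N: "noetherian_domain (class_ring :: 'a ring)" and n: "n > 0"
    and M: "M \<in> carrier_mat n n" and Y: "Y \<in> carrier_mat n n" and Q: "Q \<in> carrier_mat n n"
    and MQ: "map_mat to_fract M * Q = Q * map_mat to_fract Y"
  shows "\<exists>m w. (\<forall>j\<in>{1..m}. w j \<in> carrier_vec n) \<and>
    (\<forall>l\<in>level n Q. \<forall>v\<in>carrier_vec n. level_mat n Q l *\<^sub>v v \<in> krylov n M m w) \<and>
    (\<forall>q\<in>krylov n M m w. \<exists>l v. (\<forall>j<m. l j \<in> level n Q \<and> v j \<in> carrier_vec n) \<and>
      q = finsum_vec TYPE('a) n (\<lambda>j. level_mat n Q (l j) *\<^sub>v v j) {..<m})"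
proof -
  note L = ideal_level[OF Q]
  obtain t and a :: "nat \<Rightarrow> 'a" where a: "\<And>i. i < t \<Longrightarrow> a i \<in> level n Q"
    and span: "level n Q = {\<Sum>i<t. r i * a i | r. True}"
    using noetherian_class_fin_gen[OF N L] by blast
  \<comment> \<open>One Krylov generator for each pair of a generator of the level and a column.
    Numbers start at 1, so j stands for generator (j - 1) div n and column (j - 1) mod n.\<close>
  define m where "m = t * n"
  define b where "b j = a ((j - 1) div n)" for j
  define w where "w j = col (level_mat n Q (b j)) ((j - 1) mod n)" for j
  have b: "b j \<in> level n Q" if "j \<in> {1..m}" for j
    unfolding b_def using that by (intro a less_mult_imp_div_less) (auto simp: m_def)
  have we: "w j = level_mat n Q (b j) *\<^sub>v unit_vec n ((j - 1) mod n)" for j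
    unfolding w_def using n by (intro col_eq_mult_unit_vec[OF level_mat_carrier]) simp
  have w: "w j \<in> carrier_vec n" for j
    unfolding we by (rule mult_mat_vec_carrier[OF level_mat_carrier]) simp
  let ?K = "krylov n M m w"
  have K: "submod n ?K" by (rule submod_krylov[OF M w])
  have gen_a: "level_mat n Q (a i) *\<^sub>v v \<in> ?K" if i: "i < t" and v: "v \<in> carrier_vec n" for i v
  proof -
    have "col (level_mat n Q (a i)) c \<in> ?K" if c: "c < n" for c
    proof -
      have "i * n + c < t * n"
      proof -
        have "i * n + c < Suc i * n" using c by simp
        also have "\<dots> \<le> t * n" using i by (intro mult_le_mono1) simp
        finally show ?thesis .
      qed
      then have "Suc (i * n + c) \<in> {1..m}" by (simp add: m_def)
      then have "w (Suc (i * n + c)) \<in> ?K" using krylov_generator[where w = w, OF M w n] by simp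
      then show ?thesis using c by (simp add: w_def b_def)
    qed
    then show ?thesis unfolding mult_mat_vec_eq_finsum_cols[OF level_mat_carrier v]
      using K by (intro submod_finsum[OF K]) (auto simp: submod_def)
  qed
  have gen: "level_mat n Q l *\<^sub>v v \<in> ?K" if l: "l \<in> level n Q" and v: "v \<in> carrier_vec n" for l v
  proof -
    obtain r where l_eq: "l = (\<Sum>i<t. r i * a i)" using l unfolding span by blast
    have "r i \<cdot>\<^sub>v (level_mat n Q (a i) *\<^sub>v v) \<in> ?K" if "i \<in> {..<t}" for i
      using gen_a[of i v] that v K by (auto simp: submod_def)
    then have "finsum_vec TYPE('a) n (\<lambda>i. r i \<cdot>\<^sub>v (level_mat n Q (a i) *\<^sub>v v)) {..<t} \<in> ?K"
      by (intro submod_finsum[OF K]) auto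
    also have "finsum_vec TYPE('a) n (\<lambda>i. r i \<cdot>\<^sub>v (level_mat n Q (a i) *\<^sub>v v)) {..<t} =
        level_mat n Q l *\<^sub>v v"
      unfolding l_eq by (rule level_mat_lincomb_mult_vec[OF Q a v, symmetric])
    finally show ?thesis .
  qed
  have rep: "\<exists>l v. (\<forall>j<m. l j \<in> level n Q \<and> v j \<in> carrier_vec n) \<and>
      q = finsum_vec TYPE('a) n (\<lambda>j. level_mat n Q (l j) *\<^sub>v v j) {..<m}" if qK: "q \<in> ?K" for q
  proof -
    obtain c where q: "q = finsum_vec TYPE('a) n
        (\<lambda>j. finsum_vec TYPE('a) n (\<lambda>i. c i j \<cdot>\<^sub>v ((M ^\<^sub>m i) *\<^sub>v w j)) {0..<n}) {1..m}"
      using qK unfolding krylov_def by blast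
    \<comment> \<open>The inner Krylov sum over M^i w_j becomes a single vector l Q u_j, with l =
      \<open>b j\<close>, once every M^i is moved past l Q and turned into Y^i.\<close>
    define u where "u j = finsum_vec TYPE('a) n
      (\<lambda>i. c i j \<cdot>\<^sub>v ((Y ^\<^sub>m i) *\<^sub>v unit_vec n ((j - 1) mod n))) {0..<n}" for j
    have e: "unit_vec n k \<in> carrier_vec n" for k by simp
    have Ye: "Y ^\<^sub>m i *\<^sub>v unit_vec n k \<in> carrier_vec n" for i k
      by (rule mult_mat_vec_carrier[OF pow_carrier_mat[OF Y] e])
    have cYe: "c i j \<cdot>\<^sub>v (Y ^\<^sub>m i *\<^sub>v unit_vec n k) \<in> carrier_vec n" for i j k using Ye by simp
    have u: "u j \<in> carrier_vec n" for j unfolding u_def by (rule finsum_vec_carrier[OF cYe])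
    have Nu: "level_mat n Q (b j) *\<^sub>v u j \<in> carrier_vec n" for j
      by (rule mult_mat_vec_carrier[OF level_mat_carrier u])
    have "finsum_vec TYPE('a) n (\<lambda>i. c i j \<cdot>\<^sub>v ((M ^\<^sub>m i) *\<^sub>v w j)) {0..<n} = level_mat n Q (b j) *\<^sub>v u j"
      if j: "j \<in> {1..m}" for j
    proof -
      have "level_mat n Q (b j) *\<^sub>v u j = finsum_vec TYPE('a) n
          (\<lambda>i. level_mat n Q (b j) *\<^sub>v (c i j \<cdot>\<^sub>v ((Y ^\<^sub>m i) *\<^sub>v unit_vec n ((j - 1) mod n)))) {0..<n}"
        unfolding u_def by (rule mult_mat_vec_finsum[OF level_mat_carrier _ cYe]) simp
      also have "\<dots> = finsum_vec TYPE('a) n (\<lambda>i. c i j \<cdot>\<^sub>v ((M ^\<^sub>m i) *\<^sub>v w j)) {0..<n}"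
      proof (rule finsum_vec_cong)
        fix i
        show "level_mat n Q (b j) *\<^sub>v (c i j \<cdot>\<^sub>v ((Y ^\<^sub>m i) *\<^sub>v unit_vec n ((j - 1) mod n))) =
            c i j \<cdot>\<^sub>v ((M ^\<^sub>m i) *\<^sub>v w j)"
          unfolding mult_mat_vec_smult[OF level_mat_carrier Ye] we
            level_mat_intertwines_pow[OF M Y Q MQ b[OF j] e] ..
        show "c i j \<cdot>\<^sub>v ((M ^\<^sub>m i) *\<^sub>v w j) \<in> carrier_vec n" by (rule krylov_term_carrier[where w = w, OF M w])
      qed
      finally show ?thesis by simp
    qed
    then have "q = finsum_vec TYPE('a) n (\<lambda>j. level_mat n Q (b j) *\<^sub>v u j) {1..m}"
      unfolding q by (intro finsum_vec_cong Nu) auto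
    also have "\<dots> = finsum_vec TYPE('a) n (\<lambda>j. level_mat n Q (b (Suc j)) *\<^sub>v u (Suc j)) {..<m}"
      by (rule finsum_vec_shift[OF Nu])
    finally show ?thesis using b u by (intro exI[of _ "\<lambda>j. b (Suc j)"] exI[of _ "\<lambda>j. u (Suc j)"]) auto
  qed
  show ?thesis
    by (intro exI[of _ m] exI[of _ w] conjI ballI w gen rep)
qed

text \<open>Applying \<open>to_fract\<close> to sums of vectors l Q v over R gives exactly the sums
  that define the module image. Sums of arbitrary length are absorbed because K is a submodule,
  while \<open>rep\<close> may fix the length m.\<close>

lemma module_image_level_eq:
  fixes Q :: "'a::idom fract mat" and m :: nat
  assumes Q: "Q \<in> carrier_mat n n" and K: "submod n K"
    and gen: "\<And>l v. l \<in> level n Q \<Longrightarrow> v \<in> carrier_vec n \<Longrightarrow> level_mat n Q l *\<^sub>v v \<in> K"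
    and rep: "\<And>q. q \<in> K \<Longrightarrow> \<exists>l v. (\<forall>j<m. l j \<in> level n Q \<and> v j \<in> carrier_vec n) \<and>
      q = finsum_vec TYPE('a) n (\<lambda>j. level_mat n Q (l j) *\<^sub>v v j) {..<m}"
  shows "module_image n (level n Q) Q = map_vec to_fract ` K"
proof -
  have eq: "map_vec to_fract (finsum_vec TYPE('a) n (\<lambda>j. level_mat n Q (l j) *\<^sub>v v j) {..<k}) =
      finsum_vec TYPE('a fract) n (\<lambda>i. to_fract (l i) \<cdot>\<^sub>v (Q *\<^sub>v map_vec to_fract (v i))) {..<k}"
    if lv: "\<forall>j<k. l j \<in> level n Q \<and> v j \<in> carrier_vec n" for k :: nat and l v
  proof -
    have lv': "l j \<in> level n Q" "v j \<in> carrier_vec n" if "j \<in> {..<k}" for j using lv that by auto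
    have "map_vec to_fract (finsum_vec TYPE('a) n (\<lambda>j. level_mat n Q (l j) *\<^sub>v v j) {..<k}) =
        finsum_vec TYPE('a fract) n (\<lambda>j. map_vec to_fract (level_mat n Q (l j) *\<^sub>v v j)) {..<k}"
      by (rule map_vec_finsum) (simp_all add: mult_mat_vec_carrier[OF level_mat_carrier lv'(2)])
    also have "\<dots> = finsum_vec TYPE('a fract) n (\<lambda>i. to_fract (l i) \<cdot>\<^sub>v (Q *\<^sub>v map_vec to_fract (v i))) {..<k}"
    proof (rule finsum_vec_cong)
      fix i assume i: "i \<in> {..<k}"
      show "map_vec to_fract (level_mat n Q (l i) *\<^sub>v v i) = to_fract (l i) \<cdot>\<^sub>v (Q *\<^sub>v map_vec to_fract (v i))"
        by (rule map_level_mat_mult_vec[OF Q lv'[OF i]])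
      have "Q *\<^sub>v map_vec to_fract (v i) \<in> carrier_vec n"
        by (rule mult_mat_vec_carrier[OF Q]) (use lv'(2)[OF i] in simp)
      then show "to_fract (l i) \<cdot>\<^sub>v (Q *\<^sub>v map_vec to_fract (v i)) \<in> carrier_vec n" by simp
    qed
    finally show ?thesis .
  qed
  show ?thesis
  proof (intro equalityI subsetI)
    fix x assume "x \<in> module_image n (level n Q) Q"
    then obtain k :: nat and l v where lv: "\<forall>i<k. l i \<in> level n Q \<and> v i \<in> carrier_vec n"
      and x: "x = finsum_vec TYPE('a fract) n (\<lambda>i. to_fract (l i) \<cdot>\<^sub>v (Q *\<^sub>v map_vec to_fract (v i))) {..<k}"
      unfolding module_image_def by blast
    have "finsum_vec TYPE('a) n (\<lambda>j. level_mat n Q (l j) *\<^sub>v v j) {..<k} \<in> K"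
      using lv by (intro submod_finsum[OF K] gen) auto
    then show "x \<in> map_vec to_fract ` K" unfolding x eq[OF lv, symmetric] by (rule imageI)
  next
    fix x assume "x \<in> map_vec to_fract ` K"
    then obtain q where q: "q \<in> K" "x = map_vec to_fract q" by blast
    obtain l v where lv: "\<forall>j<m. l j \<in> level n Q \<and> v j \<in> carrier_vec n"
      "q = finsum_vec TYPE('a) n (\<lambda>j. level_mat n Q (l j) *\<^sub>v v j) {..<m}"
      using rep[OF q(1)] by (elim exE conjE)
    show "x \<in> module_image n (level n Q) Q"
      unfolding q(2) lv(2) eq[OF lv(1)] module_image_def using lv(1)
      by (intro CollectI exI[of _ m] exI[of _ l] exI[of _ v] conjI refl)
  qed
qed

text \<open>If \<open>L Q\<close> vanished modulo \<open>P\<close>, then \<open>P\<^sup>-\<^sup>1 L\<close> would be contained in the level \<open>L\<close>.\<close>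

lemma level_mat_not_zero_mod:
  fixes Q :: "'a::idom fract mat"
  assumes D: "dedekind_domain TYPE('a)" and P: "primeideal P class_ring" "P \<noteq> {0}"
    and Q: "Q \<in> carrier_mat n n" and LP: "level n Q \<subseteq> P"
  obtains l i j where "l \<in> level n Q" "i < n" "j < n" "level_mat n Q l $$ (i,j) \<notin> P"
proof (rule ccontr)
  note witness = that
  assume "\<not> thesis"
  then have zero: "level_mat n Q l $$ (i,j) \<in> P" if "l \<in> level n Q" "i < n" "j < n" for l i j
    using witness that by blast
  obtain a where a: "a \<notin> range to_fract" "\<And>y. y \<in> P \<Longrightarrow> a * to_fract y \<in> range to_fract"
    using dedekind_prime_inverse[OF D P] by blast
  \<comment> \<open>The product a l lies in R because l is in P, and a l Q has entries in R because
    those of l Q are in P. So a stabilizes the level, which is a nonzero ideal, and must be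
    integral.\<close>
  have "\<exists>y\<in>level n Q. a * to_fract l = to_fract y" if l: "l \<in> level n Q" for l
  proof -
    obtain y where y: "a * to_fract l = to_fract y" using a(2) l LP by blast
    have "y \<in> level n Q" unfolding level_iff[OF Q]
    proof (intro allI impI)
      fix i j assume ij: "i < n" "j < n"
      have "to_fract y * Q $$ (i,j) = a * to_fract (level_mat n Q l $$ (i,j))"
        unfolding y[symmetric] to_fract_level_mat_index[OF Q l ij] by (rule mult.assoc)
      then show "to_fract y * Q $$ (i,j) \<in> range to_fract" using a(2)[OF zero[OF l ij]] by simp
    qed
    then show ?thesis using y by blast
  qed
  then have "a \<in> range to_fract"
    by (rule dedekind_ideal_stable_imp_integral[OF D ideal_level[OF Q] level_nonzero[OF Q]])
  then show False using a(1) by contradiction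
qed

theorem theorem2p9:
  fixes \<X> \<Y> :: "'a::idom mat" and \<Q> :: "'a fract mat"
    and P :: "'a set" and \<Gamma> :: "'a set list" and n e :: nat
  assumes "dedekind_domain TYPE('a)"
    and "\<X> \<in> carrier_mat n n" and "transpose_mat \<X> = \<X>"
    and "\<Y> \<in> carrier_mat n n"
    and "\<Q> \<in> carrier_mat n n" and "\<Q> \<noteq> 0\<^sub>m n n"
    and "map_mat to_fract \<X> * \<Q> = \<Q> * map_mat to_fract \<Y>"
    and "transpose_mat \<Q> * \<Q> \<in> integral_mats n"
    and "primeideal P class_ring" and "P \<noteq> {0}"
    and "is_approx_sqrt P \<X> \<Gamma>"
    and "e \<ge> 1" and "ideal_dvd (ideal_pow P e) (level n \<Q>)"
  shows "\<exists>(m::nat) w. m \<ge> 1 \<and> (\<forall>j\<in>{1..m}. w j \<in> carrier_vec n) \<and>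
           (\<exists>j\<in>{1..m}. \<not> vec_cong0 (w j) P) \<and>
           contractive n \<X> \<Gamma> P e (krylov n \<X> m w) \<and>
           isotropic (ideal_pow P (2 * e)) (krylov n \<X> m w) \<and>
           module_image n (level n \<Q>) \<Q> = map_vec to_fract ` krylov n \<X> m w"
proof -
  note D = assms(1) and X = assms(2) and sym = assms(3) and Y = assms(4) and Q = assms(5)
    and XQ = assms(7) and QQ = assms(8) and P = assms(9,10)
  have I: "ideal P class_ring" using P(1) by (simp add: primeideal_def)
  note Ie = ideal_ideal_pow[OF I, of "2 * e"]
  have n: "n > 0"
  proof (rule ccontr)
    assume "\<not> n > 0"
    then have "\<Q> = 0\<^sub>m n n" using Q by (intro eq_matI) auto
    then show False using assms(6) by contradiction
  qed
  have noeth: "noetherian_domain (class_ring :: 'a ring)" using D by (simp add: dedekind_domain_def)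
  have LPe: "level n \<Q> \<subseteq> ideal_pow P e" by (rule ideal_dvd_subset[OF ideal_ideal_pow[OF I] assms(13)])
  have LP: "level n \<Q> \<subseteq> P"
    using LPe ideal_pow_antimono[OF I \<open>e \<ge> 1\<close>] unfolding ideal_pow_1[OF I] by (rule subset_trans)
  obtain m w where "\<forall>j\<in>{1..m}. w j \<in> carrier_vec n"
    and "\<forall>l\<in>level n \<Q>. \<forall>v\<in>carrier_vec n. level_mat n \<Q> l *\<^sub>v v \<in> krylov n \<X> m w"
    and "\<forall>q\<in>krylov n \<X> m w. \<exists>l v. (\<forall>j<m. l j \<in> level n \<Q> \<and> v j \<in> carrier_vec n) \<and>
      q = finsum_vec TYPE('a) n (\<lambda>j. level_mat n \<Q> (l j) *\<^sub>v v j) {..<m}"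
    using level_krylov[OF noeth n X Y Q XQ] by (elim exE conjE) (rule that)
  note w = bspec[OF this(1)] and gen = bspec[OF bspec[OF this(2)]] and rep = bspec[OF this(3)]
  define K where "K = krylov n \<X> m w"
  note gen = gen[folded K_def] and rep = rep[folded K_def]
  have K: "submod n K" unfolding K_def by (rule submod_krylov[OF X w])
  have Kc: "K \<subseteq> carrier_vec n" using K by (simp add: submod_def)
  \<comment> \<open>K is the least submodule containing all l Q v, so an inclusion of K in a
    submodule needs checking only on these vectors.\<close>
  have K_min: "K \<subseteq> N" if N: "submod n N"
    and "\<And>l v. l \<in> level n \<Q> \<Longrightarrow> v \<in> carrier_vec n \<Longrightarrow> level_mat n \<Q> l *\<^sub>v v \<in> N" for N
  proof
    fix q assume qK: "q \<in> K"
    obtain l v where lv: "\<forall>j<m. l j \<in> level n \<Q> \<and> v j \<in> carrier_vec n"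
      "q = finsum_vec TYPE('a) n (\<lambda>j. level_mat n \<Q> (l j) *\<^sub>v v j) {..<m}"
      using rep[OF qK] by (elim exE conjE)
    show "q \<in> N" unfolding lv(2) by (rule submod_finsum[OF N]) (use lv(1) that(2) in auto)
  qed
  \<comment> \<open>Krylov sums stop at the power n - 1; invariance nevertheless follows from X l Q
    v = l Q Y v, without the Cayley-Hamilton theorem.\<close>
  have K_inv: "\<X> *\<^sub>v q \<in> K" if "q \<in> K" for q
  proof -
    have "submod n {q \<in> carrier_vec n. \<X> *\<^sub>v q \<in> K}"
      using K X mult_add_distrib_mat_vec[OF X] mult_mat_vec_smult[OF X] mult_mat_zero_vec[OF X]
      by (auto simp: submod_def)
    moreover have "level_mat n \<Q> l *\<^sub>v v \<in> {q \<in> carrier_vec n. \<X> *\<^sub>v q \<in> K}"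
      if l: "l \<in> level n \<Q>" and v: "v \<in> carrier_vec n" for l v
    proof -
      have "\<X> *\<^sub>v (level_mat n \<Q> l *\<^sub>v v) = level_mat n \<Q> l *\<^sub>v (\<Y> *\<^sub>v v)"
        using assoc_mult_mat_vec[OF X level_mat_carrier v] assoc_mult_mat_vec[OF level_mat_carrier Y v]
          level_mat_intertwines[OF X Y Q XQ l] by metis
      then show ?thesis using gen[OF l mult_mat_vec_carrier[OF Y v]]
        mult_mat_vec_carrier[OF level_mat_carrier v] by simp
    qed
    ultimately have "K \<subseteq> {q \<in> carrier_vec n. \<X> *\<^sub>v q \<in> K}" by (rule K_min)
    then show ?thesis using that by blast
  qed
  have iso: "isotropic (ideal_pow P (2 * e)) K"
  proof -
    define G where "G = {level_mat n \<Q> l *\<^sub>v v | l v. l \<in> level n \<Q> \<and> v \<in> carrier_vec n}"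
    have G: "G \<subseteq> carrier_vec n" unfolding G_def using mult_mat_vec_carrier[OF level_mat_carrier] by auto
    have GG: "g \<bullet> g' \<in> ideal_pow P (2 * e)" if gG: "g \<in> G" "g' \<in> G" for g g'
    proof -
      obtain l v l' v' where lv: "g = level_mat n \<Q> l *\<^sub>v v" "l \<in> level n \<Q>" "v \<in> carrier_vec n"
        "g' = level_mat n \<Q> l' *\<^sub>v v'" "l' \<in> level n \<Q>" "v' \<in> carrier_vec n"
        using gG unfolding G_def by blast
      have "l * l' \<in> ideal_pow P (2 * e)"
        using ideal_pow_mult[OF I, of l e l' e] lv LPe by (auto simp: mult_2)
      then show ?thesis
        using level_mat_scalar_prod_dvd[OF Q QQ lv(2,5,3,6)] class_ideal_mult_right[OF Ie]
        unfolding lv(1,4) dvd_def by auto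
    qed
    \<comment> \<open>Isotropy is extended one argument at a time: first K against the vectors l Q
      v, then, after exchanging the arguments, K against K.\<close>
    have KG: "K \<subseteq> {q \<in> carrier_vec n. \<forall>b\<in>G. q \<bullet> b \<in> ideal_pow P (2 * e)}"
    proof (rule K_min[OF submod_orthogonal[OF Ie G]])
      fix l and v :: "'a vec" assume "l \<in> level n \<Q>" "v \<in> carrier_vec n"
      then have "level_mat n \<Q> l *\<^sub>v v \<in> G" unfolding G_def by blast
      then show "level_mat n \<Q> l *\<^sub>v v \<in> {q \<in> carrier_vec n. \<forall>b\<in>G. q \<bullet> b \<in> ideal_pow P (2 * e)}"
        using GG G by blast
    qed
    have "K \<subseteq> {q \<in> carrier_vec n. \<forall>b\<in>K. q \<bullet> b \<in> ideal_pow P (2 * e)}"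
    proof (rule K_min[OF submod_orthogonal[OF Ie Kc]])
      fix l and v :: "'a vec" assume "l \<in> level n \<Q>" "v \<in> carrier_vec n"
      then have g: "level_mat n \<Q> l *\<^sub>v v \<in> G" unfolding G_def by blast
      have "(level_mat n \<Q> l *\<^sub>v v) \<bullet> b \<in> ideal_pow P (2 * e)" if b: "b \<in> K" for b
      proof -
        have "b \<bullet> (level_mat n \<Q> l *\<^sub>v v) \<in> ideal_pow P (2 * e)" using KG b g by blast
        moreover have "b \<bullet> (level_mat n \<Q> l *\<^sub>v v) = (level_mat n \<Q> l *\<^sub>v v) \<bullet> b"
          by (rule comm_scalar_prod[OF subsetD[OF Kc b] subsetD[OF G g]])
        ultimately show ?thesis by simp
      qed
      then show "level_mat n \<Q> l *\<^sub>v v \<in> {q \<in> carrier_vec n. \<forall>b\<in>K. q \<bullet> b \<in> ideal_pow P (2 * e)}"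
        using subsetD[OF G g] by blast
    qed
    then show ?thesis unfolding isotropic_def by blast
  qed
  have contr: "contractive n \<X> \<Gamma> P e K"
    by (rule contractive_of_isotropic[OF D X sym P assms(11) Kc K_inv iso])
  have image: "module_image n (level n \<Q>) \<Q> = map_vec to_fract ` K"
    by (rule module_image_level_eq[OF Q K gen rep])
  have nonzero: "\<exists>j\<in>{1..m}. \<not> vec_cong0 (w j) P"
  proof (rule ccontr)
    assume "\<not> ?thesis"
    then have w0: "vec_cong0 (w j) P" if "j \<in> {1..m}" for j using that by blast
    obtain l i j where lij: "l \<in> level n \<Q>" "i < n" "j < n" "level_mat n \<Q> l $$ (i,j) \<notin> P"
      by (rule level_mat_not_zero_mod[OF D P Q LP])
    \<comment> \<open>An entry of l Q outside P lies in a column of l Q, which is an element of K;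
      were all w_j zero modulo P, K would be too.\<close>
    have h: "level_mat n \<Q> l *\<^sub>v unit_vec n j \<in> krylov n \<X> m w"
      using gen[OF lij(1), of "unit_vec n j"] unfolding K_def by simp
    have "(level_mat n \<Q> l *\<^sub>v unit_vec n j) $ i \<in> P"
      by (rule krylov_in_ideal[OF I X w w0 h lij(2)])
    then have "col (level_mat n \<Q> l) j $ i \<in> P"
      unfolding col_eq_mult_unit_vec[OF level_mat_carrier lij(3)] .
    then show False using lij by (simp add: level_mat_def)
  qed
  then have "m \<ge> 1" by auto
  then show ?thesis
    using w nonzero contr iso image unfolding K_def by (intro exI[of _ m] exI[of _ w]) auto
qed

end
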